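(* Let $G$ be a graph, $r_1,\dots,r_k$ integers and $V_1,\dots,V_k$ a partition of the vertices of $G$ such that (1) for all $i$, $\mathrm{rank}(G_{V_i})\le r_i$, and (2) for all $i\neq j$, $(r_i,r_j)\in\mathrm{birank}(G(V_i,V_j))$. Then $\mathrm{rank}(G)\le r_1+\cdots+r_k$, and in particular $\mathrm{mlt}(G)\le r_1+\cdots+r_k$.
   Context: Graphs are finite, simple, undirected. For a graph $H=(V,E)$ on $m$ vertices: $Sym(m,n)$ is the set of symmetric $m\times m$ matrices of rank at most $n$; $\phi_H(\Sigma)=(\sigma_{ii})_{i\in V}\oplus(\sigma_{ij})_{ij\in E}$; $\mathrm{rank}(H)$ is the smallest $n$ with $\dim\phi_H(Sym(m,n))=\#V+\#E$. $\mathrm{mlt}(H)$ is the smallest $n$ such that for almost all $\Sigma_0\in Sym(m,n)\cap\mathbb{S}^m_{\ge0}$ (equivalently $\Sigma_0=P^TP$ for Lebesgue-almost all $P\in\mathbb{R}^{n\times m}$) there is a positive definite $\Sigma$ with $\phi_H(\Sigma_0)=\phi_H(\Sigma)$. $G_{V_i}$ is the induced subgraph on $V_i$; for disjoint $V_i,V_j$, $G(V_i,V_j)$ is the bipartite graph with bipartition $(V_i,V_j)$ whose edges are the edges of $G$ with one endpoint in $V_i$ and the other in $V_j$. Bipartite rank: for a bipartite graph $B=(U_1,U_2,E)$ with fixed bipartition, $\#U_1=m_1$, $\#U_2=m_2$ (edges $ij$, $i\in U_1$, $j\in U_2$, index entries of $m_1\times m_2$ matrices), and integers $r_1,r_2$,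 let $L^{(X,Y)}_{r_1,r_2}=\{XA+BY: A\in\mathbb{C}^{r_1\times m_2}, B\in\mathbb{C}^{m_1\times r_2}\}$ for $X\in\mathbb{C}^{m_1\times r_1}$, $Y\in\mathbb{C}^{r_2\times m_2}$, and $\phi_E:\mathbb{C}^{m_1\times m_2}\to\mathbb{C}^E$ the projection onto the entries indexed by $E$. $\mathrm{birank}(B)$ is the set of pairs $(r_1,r_2)$ such that $\phi_E(L^{(X,Y)}_{r_1,r_2})=\mathbb{C}^E$ for generic $X,Y$. *)

theory Defs
  imports "HOL-Analysis.Analysis"
begin

section \<open>Zariski topology and dimension\<close>

text \<open>Affine space over a field with coordinates indexed by \<open>I\<close> is the set \<open>I \<rightarrow>\<^sub>E UNIV\<close>.\<close>

inductive_set poly_funs :: "'i set \<Rightarrow> (('i \<Rightarrow> 'k::comm_ring_1) \<Rightarrow> 'k) set" for I :: "'i set" where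
  const: "(\<lambda>x. c) \<in> poly_funs I"
| coord: "i \<in> I \<Longrightarrow> (\<lambda>x. x i) \<in> poly_funs I"
| add: "p \<in> poly_funs I \<Longrightarrow> q \<in> poly_funs I \<Longrightarrow> (\<lambda>x. p x + q x) \<in> poly_funs I"
| mult: "p \<in> poly_funs I \<Longrightarrow> q \<in> poly_funs I \<Longrightarrow> (\<lambda>x. p x * q x) \<in> poly_funs I"

definition zariski :: "'i set \<Rightarrow> ('i \<Rightarrow> 'k::field) topology" where
  "zariski I = topology_generated_by
     ((\<lambda>p. {x \<in> I \<rightarrow>\<^sub>E UNIV. p x \<noteq> 0}) ` poly_funs I)"

definition irreducible_in :: "'a topology \<Rightarrow> 'a set \<Rightarrow> bool" where
  "irreducible_in X Z \<longleftrightarrow> Z \<subseteq> topspace X \<and> Z \<noteq> {} \<and>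
     (\<forall>A B. closedin X A \<and> closedin X B \<and> Z \<subseteq> A \<union> B \<longrightarrow> Z \<subseteq> A \<or> Z \<subseteq> B)"

definition krull_dim :: "'a topology \<Rightarrow> enat" where
  "krull_dim X = Sup {enat n | n. \<exists>Z :: nat \<Rightarrow> 'a set.
     (\<forall>i\<le>n. closedin X (Z i) \<and> irreducible_in X (Z i)) \<and> (\<forall>i<n. Z i \<subset> Z (Suc i))}"

text \<open>The dimension of an arbitrary (in practice semialgebraic or constructible) subset of
  affine space is the dimension of its Zariski closure.\<close>

definition zariski_dim :: "'i set \<Rightarrow> ('i \<Rightarrow> 'k::field) set \<Rightarrow> enat" where
  "zariski_dim I S = krull_dim (subtopology (zariski I) (zariski I closure_of S))"

text \<open>A property holds for a generic point if it holds on a nonempty Zariski-open set.\<close>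

definition generically :: "'i set \<Rightarrow> (('i \<Rightarrow> 'k::field) \<Rightarrow> bool) \<Rightarrow> bool" where
  "generically I P \<longleftrightarrow> (\<exists>W. openin (zariski I) W \<and> W \<noteq> {} \<and> (\<forall>x\<in>W. P x))"


section \<open>Graphs\<close>

record 'v ugraph =
  verts :: "'v set"
  edges :: "'v set set"

definition simple_graph :: "'v ugraph \<Rightarrow> bool" where
  "simple_graph G \<longleftrightarrow> finite (verts G) \<and> (\<forall>e\<in>edges G. e \<subseteq> verts G \<and> card e = 2)"

definition induced :: "'v ugraph \<Rightarrow> 'v set \<Rightarrow> 'v ugraph" where
  "induced G U = \<lparr>verts = U, edges = {e \<in> edges G. e \<subseteq> U}\<rparr>"

text \<open>With the bipartition fixed, an edge is stored as the pair of its endpoint in \<open>left\<close> and its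
  endpoint in \<open>right\<close>, so that edges are positions in a matrix.\<close>

record 'v bigraph =
  left :: "'v set"
  right :: "'v set"
  biedges :: "('v \<times> 'v) set"

definition between :: "'v ugraph \<Rightarrow> 'v set \<Rightarrow> 'v set \<Rightarrow> 'v bigraph" where
  "between G U W = \<lparr>left = U, right = W, biedges = {(i, j). i \<in> U \<and> j \<in> W \<and> {i, j} \<in> edges G}\<rparr>"


section \<open>Rank and maximum likelihood threshold\<close>

text \<open>A matrix with rows and columns indexed by \<open>U\<close> is stored as a matrix over the whole index
  type that vanishes outside \<open>U \<times> U\<close>; this does not change its rank.\<close>

definition sym_on :: "'v set \<Rightarrow> (real^'v^'v::finite) set" where
  "sym_on U = {S. transpose S = S \<and> (\<forall>i j. i \<notin> U \<or> j \<notin> U \<longrightarrow> S $ i $ j = 0)}"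

definition sym_rank_le :: "'v set \<Rightarrow> nat \<Rightarrow> (real^'v^'v::finite) set" where
  "sym_rank_le U n = {S \<in> sym_on U. rank S \<le> n}"

definition pos_def_on :: "'v set \<Rightarrow> real^'v^'v::finite \<Rightarrow> bool" where
  "pos_def_on U S \<longleftrightarrow> S \<in> sym_on U \<and>
     (\<forall>x. x \<noteq> 0 \<and> (\<forall>i. i \<notin> U \<longrightarrow> x $ i = 0) \<longrightarrow> x \<bullet> (S *v x) > 0)"

abbreviation coords :: "'v ugraph \<Rightarrow> ('v + 'v set) set" where
  "coords G \<equiv> verts G <+> edges G"

text \<open>The entry at an edge is well defined because \<open>phi\<close> is only applied to symmetric matrices.\<close>

definition phi :: "'v ugraph \<Rightarrow> real^'v^'v::finite \<Rightarrow> ('v + 'v set \<Rightarrow> real)" where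
  "phi G S = (\<lambda>c \<in> coords G. case c of
       Inl i \<Rightarrow> S $ i $ i
     | Inr e \<Rightarrow> (THE s. \<exists>i j. e = {i, j} \<and> s = S $ i $ j))"

definition graph_rank :: "'v::finite ugraph \<Rightarrow> nat" where
  "graph_rank G = (LEAST n.
     zariski_dim (coords G) (phi G ` sym_rank_le (verts G) n)
       = enat (card (verts G) + card (edges G)))"

definition gram :: "'v set \<Rightarrow> nat \<Rightarrow> (nat \<times> 'v \<Rightarrow> real) \<Rightarrow> real^'v^'v::finite" where
  "gram U n P = (\<chi> i j. if i \<in> U \<and> j \<in> U then \<Sum>s<n. P (s, i) * P (s, j) else 0)"

definition mlt :: "'v::finite ugraph \<Rightarrow> nat" where
  "mlt G = (LEAST n.
     AE P in Pi\<^sub>M ({..<n} \<times> verts G) (\<lambda>_. lborel).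
       \<exists>S. pos_def_on (verts G) S \<and> phi G (gram (verts G) n P) = phi G S)"


section \<open>Bipartite rank\<close>

definition bi_space :: "'v bigraph \<Rightarrow> nat \<Rightarrow> nat \<Rightarrow>
    ('v \<times> nat \<Rightarrow> complex) \<Rightarrow> (nat \<times> 'v \<Rightarrow> complex) \<Rightarrow> ('v \<times> 'v \<Rightarrow> complex) set" where
  "bi_space H r1 r2 X Y =
     {(\<lambda>(i, j) \<in> left H \<times> right H. (\<Sum>s<r1. X (i, s) * A (s, j)) + (\<Sum>t<r2. B (i, t) * Y (t, j)))
      | A B. A \<in> {..<r1} \<times> right H \<rightarrow>\<^sub>E UNIV \<and> B \<in> left H \<times> {..<r2} \<rightarrow>\<^sub>E UNIV}"

text \<open>A pair of matrices \<open>(X, Y)\<close> is a single point of the affine space whose coordinates are the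
  disjoint union of the positions in \<open>X\<close> and the positions in \<open>Y\<close>.\<close>

definition birank :: "'v bigraph \<Rightarrow> (nat \<times> nat) set" where
  "birank H = {(r1, r2).
     generically ((left H \<times> {..<r1}) <+> ({..<r2} \<times> right H))
       (\<lambda>z. (\<lambda>Z. restrict Z (biedges H)) ` bi_space H r1 r2 (\<lambda>p. z (Inl p)) (\<lambda>p. z (Inr p))
            = (biedges H \<rightarrow>\<^sub>E UNIV))}"

end

theory Submission
  imports Defs "HOL-Computational_Algebra.Polynomial"
begin

text \<open>
  Call vectors \<open>vs \<rho>\<close> stress-free for a graph \<open>H\<close> if no nonzero symmetric matrix \<open>K\<close> supported on
  the diagonal and the edges of \<open>H\<close> satisfies \<open>K *v vs \<rho> = 0\<close> for all \<open>\<rho>\<close>; such a \<open>K\<close> is a linear form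
  annihilating the image of the differential of the Gram map followed by \<open>phi H\<close>.

  If a stress-free configuration of \<open>n\<close> vectors exists, the open mapping theorem makes the image
  of \<open>phi H\<close> on matrices of rank at most \<open>n\<close> contain a Euclidean ball, so it is Zariski dense.
  Conversely, density makes the entries of the Gram matrix algebraically independent (diagonalise
  symmetric matrices and let the signs of the coefficients vary), and the Jacobian criterion makes
  generic configurations stress-free. Since affine \<open>N\<close>-space has Krull dimension \<open>N\<close>, density is
  the condition in the definition of the rank. The open mapping theorem also produces positive
  definite completions at stress-free configurations, hence the bound on the threshold.

  For the theorem, place generic vectors supported on \<open>V i\<close> in the \<open>i\<close>-th block. A stress of this
  block-diagonal configuration splits: its diagonal blocks vanish by the rank hypothesis, and its
  \<open>(i, j)\<close> block is orthogonal to \<open>{X A + B Y}\<close>, so it vanishes by the birank hypothesis.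
\<close>

section \<open>Polynomial functions\<close>

lemma poly_funs_cong:
  assumes "p \<in> poly_funs I" "\<And>i. i \<in> I \<Longrightarrow> x i = y i"
  shows "p x = p y"
  using assms(1) by induction (auto simp: assms(2))

lemma poly_funs_restrict: "p \<in> poly_funs I \<Longrightarrow> p (restrict x I) = p x"
  by (rule poly_funs_cong[of p I]) auto

lemma poly_funs_compose:
  assumes "q \<in> poly_funs K" "\<And>k. k \<in> K \<Longrightarrow> h k \<in> poly_funs L"
  shows "(\<lambda>x. q (\<lambda>k. h k x)) \<in> poly_funs L"
  using assms(1)
proof induction
  case (coord i)
  then show ?case using assms(2) by simp
qed (auto intro: poly_funs.intros)

lemma poly_funs_mono:
  assumes "p \<in> poly_funs I" "I \<subseteq> J"
  shows "p \<in> poly_funs J"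
  using assms(1)
  by induction (use assms(2) in \<open>auto intro: poly_funs.intros\<close>)

lemma poly_funs_sum:
  assumes "\<And>a. a \<in> A \<Longrightarrow> f a \<in> poly_funs I"
  shows "(\<lambda>x. \<Sum>a\<in>A. f a x) \<in> poly_funs I"
  using assms
  by (induction A rule: infinite_finite_induct) (auto intro!: poly_funs.intros)

lemma poly_funs_prod:
  assumes "\<And>a. a \<in> A \<Longrightarrow> f a \<in> poly_funs I"
  shows "(\<lambda>x. \<Prod>a\<in>A. f a x) \<in> poly_funs I"
  using assms
  by (induction A rule: infinite_finite_induct) (auto intro!: poly_funs.intros)

lemma poly_funs_power:
  assumes "f \<in> poly_funs I"
  shows "(\<lambda>x. f x ^ n) \<in> poly_funs I"
  by (induction n) (auto intro!: poly_funs.intros assms)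

section \<open>Polynomial functions restricted to lines\<close>

text \<open>Restriction to a line produces a univariate \<open>poly\<close>, whose finitely many
  roots are the source of all the nonvanishing arguments below.\<close>

lemma poly_funs_line:
  fixes x v :: "'i \<Rightarrow> 'k::comm_ring_1"
  assumes "p \<in> poly_funs I"
  obtains P where "\<And>t. poly P t = p (\<lambda>i. x i + t * v i)"
proof -
  have "\<exists>P. \<forall>t. poly P t = p (\<lambda>i. x i + t * v i)"
    using assms
  proof induction
    case (const c)
    show ?case by (rule exI[of _ "[:c:]"]) simp
  next
    case (coord i)
    show ?case by (rule exI[of _ "[:x i, v i:]"]) simp
  next
    case (add p q)
    then obtain P Q where "\<forall>t. poly P t = p (\<lambda>i. x i + t * v i)"
      "\<forall>t. poly Q t = q (\<lambda>i. x i + t * v i)" by blast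
    then show ?case by (intro exI[of _ "P + Q"]) simp
  next
    case (mult p q)
    then obtain P Q where "\<forall>t. poly P t = p (\<lambda>i. x i + t * v i)"
      "\<forall>t. poly Q t = q (\<lambda>i. x i + t * v i)" by blast
    then show ?case by (intro exI[of _ "P * Q"]) simp
  qed
  then show thesis using that by blast
qed

lemma poly_funs_line_eq_0:
  fixes x v :: "'i \<Rightarrow> 'k::field"
  assumes "p \<in> poly_funs I" "infinite T" "\<And>t. t \<in> T \<Longrightarrow> p (\<lambda>i. x i + t * v i) = 0"
  shows "p (\<lambda>i. x i + s * v i) = 0"
proof -
  obtain P where P: "\<And>t. poly P t = p (\<lambda>i. x i + t * v i)"
    using poly_funs_line[OF assms(1), of x v] by blast
  have "T \<subseteq> {t. poly P t = 0}" using assms(3) P by auto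
  then have "P = 0" using assms(2) poly_roots_finite finite_subset by blast
  then show ?thesis using P[of s] by simp
qed

text \<open>Each of \<open>p\<close> and \<open>q\<close> has only finitely many zeros on the line,
  and two finite sets cannot cover an infinite field.\<close>

lemma poly_funs_line_common_nonzero:
  fixes x v :: "'i \<Rightarrow> 'k::field_char_0"
  assumes "p \<in> poly_funs I" "q \<in> poly_funs I"
    "p (\<lambda>i. x i + s * v i) \<noteq> 0" "q (\<lambda>i. x i + s' * v i) \<noteq> 0"
  shows "\<exists>t. p (\<lambda>i. x i + t * v i) \<noteq> 0 \<and> q (\<lambda>i. x i + t * v i) \<noteq> 0"
proof (rule ccontr)
  assume neg: "\<not> ?thesis"
  have fin: "finite {t. p (\<lambda>i. x i + t * v i) = 0}"
    using poly_funs_line_eq_0[OF assms(1), of "{t. p (\<lambda>i. x i + t * v i) = 0}" x v s] assms(3)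
    by blast
  have fin': "finite {t. q (\<lambda>i. x i + t * v i) = 0}"
    using poly_funs_line_eq_0[OF assms(2), of "{t. q (\<lambda>i. x i + t * v i) = 0}" x v s'] assms(4)
    by blast
  have "{t. p (\<lambda>i. x i + t * v i) = 0} \<union> {t. q (\<lambda>i. x i + t * v i) = 0} = UNIV"
    using neg by auto
  then have "finite (UNIV :: 'k set)" using finite_UnI[OF fin fin'] by simp
  then show False using infinite_UNIV_char_0[where 'a='k] by blast
qed

lemma poly_funs_mult_nonzero:
  fixes p q :: "('i \<Rightarrow> 'k::field_char_0) \<Rightarrow> 'k"
  assumes "p \<in> poly_funs I" "q \<in> poly_funs I" "p x \<noteq> 0" "q y \<noteq> 0"
  shows "\<exists>z. p z \<noteq> 0 \<and> q z \<noteq> 0"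
  using poly_funs_line_common_nonzero[OF assms(1,2), of x 0 "\<lambda>i. y i - x i" 1] assms(3,4)
  by auto

lemma poly_funs_prod_nonzero:
  fixes f :: "'a \<Rightarrow> ('i \<Rightarrow> 'k::field_char_0) \<Rightarrow> 'k"
  assumes "finite A" "\<And>a. a \<in> A \<Longrightarrow> f a \<in> poly_funs I" "\<And>a. a \<in> A \<Longrightarrow> \<exists>x. f a x \<noteq> 0"
  shows "\<exists>x. (\<Prod>a\<in>A. f a x) \<noteq> 0"
  using assms
proof (induction A rule: finite_induct)
  case (insert a A)
  obtain x y where "f a x \<noteq> 0" "(\<Prod>a\<in>A. f a y) \<noteq> 0"
    using insert.prems insert.IH by blast
  moreover have "(\<lambda>x. \<Prod>a\<in>A. f a x) \<in> poly_funs I" "f a \<in> poly_funs I"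
    using insert.prems by (auto intro: poly_funs_prod)
  ultimately obtain z where "f a z \<noteq> 0" "(\<Prod>a\<in>A. f a z) \<noteq> 0"
    using poly_funs_mult_nonzero by blast
  then show ?case using insert.hyps by (intro exI[of _ z]) simp
qed auto

text \<open>The line from \<open>x\<close> to an arbitrary \<open>z\<close> stays in the box for all
  small parameters, which are infinitely many zeros of the restriction of \<open>p\<close>.\<close>

lemma poly_funs_eq_0_near:
  fixes p :: "('i \<Rightarrow> real) \<Rightarrow> real"
  assumes "finite I" "p \<in> poly_funs I" "\<epsilon> > 0"
    and van: "\<And>y. (\<And>i. i \<in> I \<Longrightarrow> \<bar>y i - x i\<bar> < \<epsilon>) \<Longrightarrow> p y = 0"
  shows "p z = 0"
proof -
  \<comment> \<open>\<open>M\<close> bounds every coordinate of \<open>z - x\<close>; the summand 1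
    keeps it positive when that difference is zero.\<close>
  define M where "M = (\<Sum>i\<in>I. \<bar>z i - x i\<bar>) + 1"
  have M: "\<bar>z i - x i\<bar> \<le> M" if "i \<in> I" for i
    using member_le_sum[of i I "\<lambda>i. \<bar>z i - x i\<bar>"] that assms(1) unfolding M_def by simp
  have "M > 0" unfolding M_def by (simp add: add_nonneg_pos sum_nonneg)
  have "p (\<lambda>i. x i + 1 * (z i - x i)) = 0"
  proof (rule poly_funs_line_eq_0[OF assms(2)])
    show "infinite {0<..<\<epsilon> / M}" using \<open>M > 0\<close> assms(3) by (simp add: infinite_Ioo)
    fix t assume t: "t \<in> {0<..<\<epsilon> / M}"
    have "\<bar>t * (z i - x i)\<bar> < \<epsilon>" if "i \<in> I" for i
    proof -
      have "\<bar>t * (z i - x i)\<bar> \<le> t * M"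
        using M[OF that] t by (simp add: abs_mult mult_left_mono)
      also have "\<dots> < \<epsilon>" using t \<open>M > 0\<close> by (simp add: field_simps)
      finally show ?thesis .
    qed
    then show "p (\<lambda>i. x i + t * (z i - x i)) = 0" by (intro van) simp
  qed
  then show ?thesis by simp
qed

section \<open>Passing between real and complex polynomial functions\<close>

text \<open>On the line \<open>Re z + t * Im z\<close> every real \<open>t\<close> gives a real
  point, while \<open>t = \<i>\<close> gives \<open>z\<close>; vanishing at the infinitely many real
  parameters would force vanishing at \<open>z\<close>.\<close>

lemma complex_poly_nonzero_at_real:
  fixes p :: "('i \<Rightarrow> complex) \<Rightarrow> complex"
  assumes "p \<in> poly_funs I" "p z \<noteq> 0"
  shows "\<exists>x. p (\<lambda>i. complex_of_real (x i)) \<noteq> 0"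
proof (rule ccontr)
  assume neg: "\<not> ?thesis"
  have "p (\<lambda>i. of_real (Re (z i)) + \<i> * of_real (Im (z i))) = 0"
  proof (rule poly_funs_line_eq_0[OF assms(1)])
    show "infinite (range complex_of_real)"
      using infinite_UNIV_char_0[where 'a=real] by (simp add: finite_image_iff inj_on_def)
    fix t assume "t \<in> range complex_of_real"
    then obtain s where "t = of_real s" by blast
    then have "(\<lambda>i. of_real (Re (z i)) + t * of_real (Im (z i)))
        = (\<lambda>i. complex_of_real (Re (z i) + s * Im (z i)))"
      by simp
    then show "p (\<lambda>i. of_real (Re (z i)) + t * of_real (Im (z i))) = 0"
      using neg by metis
  qed
  then show False using assms(2) by (simp add: complex_eq[symmetric])
qed

lemma complexify_poly:
  fixes p :: "('i \<Rightarrow> real) \<Rightarrow> real"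
  assumes "p \<in> poly_funs I"
  obtains q where "q \<in> poly_funs I" "\<And>x. q (\<lambda>i. complex_of_real (x i)) = of_real (p x)"
proof -
  have "\<exists>q\<in>poly_funs I. \<forall>x. q (\<lambda>i. complex_of_real (x i)) = of_real (p x)"
    using assms
  proof induction
    case (const c)
    show ?case by (rule bexI[of _ "\<lambda>x. of_real c"]) (auto intro: poly_funs.intros)
  next
    case (coord i)
    then show ?case by (intro bexI[of _ "\<lambda>x. x i"]) (auto intro: poly_funs.intros)
  next
    case (add p q)
    then obtain p' q' where "p' \<in> poly_funs I" "q' \<in> poly_funs I"
      "\<forall>x. p' (\<lambda>i. complex_of_real (x i)) = of_real (p x)"
      "\<forall>x. q' (\<lambda>i. complex_of_real (x i)) = of_real (q x)" by blast
    then show ?case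
      by (intro bexI[of _ "\<lambda>x. p' x + q' x"]) (auto intro: poly_funs.intros)
  next
    case (mult p q)
    then obtain p' q' where "p' \<in> poly_funs I" "q' \<in> poly_funs I"
      "\<forall>x. p' (\<lambda>i. complex_of_real (x i)) = of_real (p x)"
      "\<forall>x. q' (\<lambda>i. complex_of_real (x i)) = of_real (q x)" by blast
    then show ?case
      by (intro bexI[of _ "\<lambda>x. p' x * q' x"]) (auto intro: poly_funs.intros)
  qed
  then show thesis using that by blast
qed

section \<open>Expansion in one variable, and zero sets as null sets\<close>

text \<open>Regards \<open>p\<close> as a polynomial in \<open>x i\<close> with coefficients in the
  other variables. That the coefficients vanish beyond \<open>d\<close> lets the induction enlarge
  degree bounds for sums and form Cauchy products.\<close>

lemma poly_funs_insert_expand: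
  fixes p :: "('i \<Rightarrow> 'k::idom) \<Rightarrow> 'k"
  assumes "p \<in> poly_funs (insert i I)"
  obtains d c where "\<And>e. c e \<in> poly_funs I" "\<And>x. p x = (\<Sum>e\<le>d. c e x * x i ^ e)"
    "\<And>e. e > d \<Longrightarrow> c e = (\<lambda>x. 0)"
proof -
  have "\<exists>d c. (\<forall>e. c e \<in> poly_funs I) \<and> (\<forall>e>d. c e = (\<lambda>x. 0)) \<and>
      (\<forall>x. p x = (\<Sum>e\<le>d. c e x * x i ^ e))"
    using assms
  proof induction
    case (const a)
    show ?case
      by (rule exI[of _ 0], rule exI[of _ "\<lambda>e. if e = 0 then (\<lambda>x. a) else (\<lambda>x. 0)"])
        (auto intro: poly_funs.intros)
  next
    case (coord j)
    show ?case
    proof (cases "j = i")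
      case True
      then show ?thesis
        by (intro exI[of _ 1] exI[of _ "\<lambda>e. if e = 1 then (\<lambda>x. 1) else (\<lambda>x. 0)"])
          (auto intro: poly_funs.intros)
    next
      case False
      then show ?thesis using coord
        by (intro exI[of _ 0] exI[of _ "\<lambda>e. if e = 0 then (\<lambda>x. x j) else (\<lambda>x. 0)"])
          (auto intro: poly_funs.intros)
    qed
  next
    case (add p q)
    then obtain d c d' c' where c: "\<forall>e. c e \<in> poly_funs I" "\<forall>e>d. c e = (\<lambda>x. 0)"
        "\<forall>x. p x = (\<Sum>e\<le>d. c e x * x i ^ e)"
      and c': "\<forall>e. c' e \<in> poly_funs I" "\<forall>e>d'. c' e = (\<lambda>x. 0)"
        "\<forall>x. q x = (\<Sum>e\<le>d'. c' e x * x i ^ e)"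
      by blast
    have "p x = (\<Sum>e\<le>max d d'. c e x * x i ^ e)" for x
      unfolding c(3)[rule_format] by (rule sum.mono_neutral_left) (use c(2) in auto)
    moreover have "q x = (\<Sum>e\<le>max d d'. c' e x * x i ^ e)" for x
      unfolding c'(3)[rule_format] by (rule sum.mono_neutral_left) (use c'(2) in auto)
    ultimately show ?case
      by (intro exI[of _ "max d d'"] exI[of _ "\<lambda>e x. c e x + c' e x"])
        (use c c' in \<open>auto intro: poly_funs.intros simp: sum.distrib algebra_simps\<close>)
  next
    case (mult p q)
    then obtain d c d' c' where c: "\<forall>e. c e \<in> poly_funs I" "\<forall>e>d. c e = (\<lambda>x. 0)"
        "\<forall>x. p x = (\<Sum>e\<le>d. c e x * x i ^ e)"
      and c': "\<forall>e. c' e \<in> poly_funs I" "\<forall>e>d'. c' e = (\<lambda>x. 0)"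
        "\<forall>x. q x = (\<Sum>e\<le>d'. c' e x * x i ^ e)"
      by blast
    have "p x * q x = (\<Sum>e\<le>d + d'. (\<Sum>k\<le>e. c k x * c' (e - k) x) * x i ^ e)" for x
      unfolding c(3)[rule_format] c'(3)[rule_format]
      by (rule polynomial_product) (use c(2) c'(2) in auto)
    moreover have "c k x * c' (e - k) x = 0" if "e > d + d'" "k \<le> e" for e k x
      using that c(2) c'(2) by (cases "k > d") auto
    ultimately show ?case
      by (intro exI[of _ "d + d'"] exI[of _ "\<lambda>e x. \<Sum>k\<le>e. c k x * c' (e - k) x"])
        (use c c' in \<open>auto intro!: poly_funs_sum poly_funs.mult sum.neutral ext\<close>)
  qed
  then show thesis using that by blast
qed

lemma poly_funs_measurable:
  fixes p :: "('i \<Rightarrow> real) \<Rightarrow> real"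
  assumes "p \<in> poly_funs I"
  shows "p \<in> borel_measurable (Pi\<^sub>M I (\<lambda>_. lborel))"
  using assms
proof induction
  case (coord i)
  then show ?case
    using measurable_component_singleton[of i I "\<lambda>_. lborel"] by simp
qed auto

text \<open>Fubini, one variable at a time: for almost all values of the other variables a fixed
  coefficient \<open>c e\<close> is nonzero by induction, and then only finitely many values of the
  last variable are roots.\<close>

lemma poly_funs_AE_nonzero:
  fixes p :: "('i \<Rightarrow> real) \<Rightarrow> real"
  assumes "finite I" "p \<in> poly_funs I" "p z \<noteq> 0"
  shows "AE x in Pi\<^sub>M I (\<lambda>_. lborel). p x \<noteq> 0"
  using assms
proof (induction I arbitrary: p z rule: finite_induct)
  case empty
  have "p x \<noteq> 0" for x
    using poly_funs_cong[OF empty(1), of x z] empty(2) by simp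
  then show ?case by simp
next
  case (insert i I)
  interpret product_sigma_finite "\<lambda>_. lborel :: real measure"
    by standard
  obtain d c where c: "\<And>e. c e \<in> poly_funs I" "\<And>x. p x = (\<Sum>e\<le>d. c e x * x i ^ e)"
    using poly_funs_insert_expand[OF insert.prems(1)] by metis
  have "\<exists>e\<le>d. c e z \<noteq> 0"
    using insert.prems(2) c(2)[of z] by (metis (no_types, lifting) atMost_iff mult_zero_left sum.neutral)
  then obtain e where e: "e \<le> d" "c e z \<noteq> 0" by blast
  let ?N = "{x \<in> space (Pi\<^sub>M (insert i I) (\<lambda>_. lborel)). p x = 0}"
  have pm: "p \<in> borel_measurable (Pi\<^sub>M (insert i I) (\<lambda>_. lborel))"
    by (rule poly_funs_measurable[OF insert.prems(1)])
  have N: "?N \<in> sets (Pi\<^sub>M (insert i I) (\<lambda>_. lborel))"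
    using pm by measurable
  have "emeasure (Pi\<^sub>M (insert i I) (\<lambda>_. lborel)) ?N
      = (\<integral>\<^sup>+x. indicator ?N x \<partial>Pi\<^sub>M (insert i I) (\<lambda>_. lborel))"
    using N by simp
  also have "\<dots> = (\<integral>\<^sup>+x. (\<integral>\<^sup>+y. indicator ?N (x(i := y)) \<partial>lborel) \<partial>Pi\<^sub>M I (\<lambda>_. lborel))"
    by (rule product_nn_integral_insert) (use insert.hyps N in auto)
  also have "\<dots> = (\<integral>\<^sup>+x. 0 \<partial>Pi\<^sub>M I (\<lambda>_. lborel :: real measure))"
  proof (rule nn_integral_cong_AE)
    show "AE x in Pi\<^sub>M I (\<lambda>_. lborel). (\<integral>\<^sup>+y. indicator ?N (x(i := y)) \<partial>lborel) = 0"
      using insert.IH[OF c(1) e(2)]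
    proof eventually_elim
      case (elim x)
      have "c e (x(i := y)) = c e x" for e y
        by (rule poly_funs_cong[OF c(1)]) (use insert.hyps(2) in auto)
      then have "p (x(i := y)) = (\<Sum>e\<le>d. c e x * y ^ e)" for y
        unfolding c(2) by simp
      moreover have "finite {y. (\<Sum>e\<le>d. c e x * y ^ e) = 0}"
        using Transcendental.polyfun_finite_roots[where n=d and c="\<lambda>e. c e x"] elim e(1) by blast
      ultimately have "finite {y. p (x(i := y)) = 0}" by simp
      then have "AE y in lborel. y \<notin> {y. p (x(i := y)) = 0}"
        by (intro AE_not_in finite_imp_null_set_lborel)
      then have "AE y in lborel. indicator ?N (x(i := y)) = (0::ennreal)"
        by eventually_elim (auto simp: indicator_def)
      then show ?case by (subst nn_integral_cong_AE[where v = "\<lambda>_. 0"]) auto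
    qed
  qed
  finally have "?N \<in> null_sets (Pi\<^sub>M (insert i I) (\<lambda>_. lborel))" using N by auto
  then show ?case by (auto intro!: AE_I')
qed

section \<open>Counting monomials and algebraic independence\<close>

text \<open>Gaussian elimination: a nonzero entry of row \<open>b\<close> serves as pivot, which
  removes one equation together with one unknown.\<close>

lemma homogeneous_system:
  fixes M :: "'b \<Rightarrow> 'a \<Rightarrow> 'k::field"
  assumes "finite B" "finite A" "card B < card A"
  shows "\<exists>u. (\<exists>a\<in>A. u a \<noteq> 0) \<and> (\<forall>b\<in>B. (\<Sum>a\<in>A. M b a * u a) = 0)"
  using assms
proof (induction B arbitrary: A M rule: finite_induct)
  case empty
  then obtain a where "a \<in> A" by fastforce
  then show ?case by (intro exI[of _ "\<lambda>_. 1"]) auto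
next
  case (insert b B)
  show ?case
  proof (cases "\<forall>a\<in>A. M b a = 0")
    case True
    obtain u where "\<exists>a\<in>A. u a \<noteq> 0" "\<forall>b\<in>B. (\<Sum>a\<in>A. M b a * u a) = 0"
      using insert.IH[OF insert.prems(1), of M] insert.prems insert.hyps by auto
    then show ?thesis using True by (intro exI[of _ u]) auto
  next
    case False
    then obtain a0 where a0: "a0 \<in> A" "M b a0 \<noteq> 0" by blast
    define A' where "A' = A - {a0}"
    have A': "finite A'" "A = insert a0 A'" "a0 \<notin> A'" using a0 insert.prems A'_def by auto
    have "card B < card A'" using insert.prems insert.hyps A' by simp
    then obtain u where u: "\<exists>a\<in>A'. u a \<noteq> 0"
      "\<forall>c\<in>B. (\<Sum>a\<in>A'. (M c a - M c a0 * M b a / M b a0) * u a) = 0"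
      using insert.IH[OF A'(1), of "\<lambda>c a. M c a - M c a0 * M b a / M b a0"] by blast
    \<comment> \<open>The eliminated unknown receives the value that equation \<open>b\<close>
      forces on it.\<close>
    define w where "w = u(a0 := - (\<Sum>a\<in>A'. M b a * u a) / M b a0)"
    have sum_A: "(\<Sum>a\<in>A. M c a * w a) = M c a0 * w a0 + (\<Sum>a\<in>A'. M c a * u a)" for c
    proof -
      have "(\<Sum>a\<in>A. M c a * w a) = M c a0 * w a0 + (\<Sum>a\<in>A'. M c a * w a)"
        using A' by simp
      also have "(\<Sum>a\<in>A'. M c a * w a) = (\<Sum>a\<in>A'. M c a * u a)"
        using A'(3) by (intro sum.cong) (auto simp: w_def)
      finally show ?thesis .
    qed
    have "(\<Sum>a\<in>A. M c a * w a) = 0" if "c \<in> insert b B" for c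
    proof (cases "c = b")
      case True
      then show ?thesis using a0(2) unfolding sum_A by (simp add: w_def)
    next
      case False
      have "(\<Sum>a\<in>A'. (M c a - M c a0 * M b a / M b a0) * u a)
          = (\<Sum>a\<in>A'. M c a * u a) - M c a0 / M b a0 * (\<Sum>a\<in>A'. M b a * u a)"
        by (simp add: sum_subtractf[symmetric] sum_distrib_left algebra_simps)
      then show ?thesis using False that u(2) unfolding sum_A by (simp add: w_def)
    qed
    moreover have "\<exists>a\<in>A. w a \<noteq> 0" using u(1) A' by (auto simp: w_def)
    ultimately show ?thesis by blast
  qed
qed

section \<open>Polynomials with bounded exponents\<close>

definition monomial :: "'i set \<Rightarrow> ('i \<Rightarrow> nat) \<Rightarrow> ('i \<Rightarrow> 'k::comm_ring_1) \<Rightarrow> 'k" where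
  "monomial I a x = (\<Prod>i\<in>I. x i ^ a i)"

lemma monomial_poly_funs: "monomial I a \<in> poly_funs I"
  unfolding monomial_def[abs_def]
  by (intro poly_funs_prod poly_funs_power poly_funs.coord)

lemma monomial_restrict: "monomial I (restrict a I) = monomial I a"
  unfolding monomial_def by (intro ext prod.cong) auto

lemma monomial_mult: "monomial I a x * monomial I b x = monomial I (\<lambda>i. a i + b i) x"
  unfolding monomial_def by (simp add: prod.distrib power_add)

text \<open>The bound applies to each exponent separately, not to the total degree: the number of
  monomials is then exactly \<open>(n + 1) ^ card I\<close>, and bounds add under
  multiplication.\<close>

inductive_set box_polys :: "'i set \<Rightarrow> nat \<Rightarrow> (('i \<Rightarrow> 'k::comm_ring_1) \<Rightarrow> 'k) set" for I n where
  zero: "(\<lambda>x. 0) \<in> box_polys I n"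
| step: "(\<And>i. i \<in> I \<Longrightarrow> a i \<le> n) \<Longrightarrow> p \<in> box_polys I n \<Longrightarrow>
    (\<lambda>x. c * monomial I a x + p x) \<in> box_polys I n"

lemma box_polys_mono:
  assumes "p \<in> box_polys I n" "n \<le> n'"
  shows "p \<in> box_polys I n'"
  using assms(1)
proof induction
  case (step a p c)
  then show ?case using assms(2) by (intro box_polys.step) (auto intro: order_trans)
qed (rule box_polys.zero)

lemma box_polys_add:
  assumes "p \<in> box_polys I n" "q \<in> box_polys I n"
  shows "(\<lambda>x. p x + q x) \<in> box_polys I n"
  using assms(1)
proof induction
  case zero
  then show ?case using assms(2) by simp
next
  case (step a p c)
  then show ?case using box_polys.step[of I a n "\<lambda>x. p x + q x" c] by (simp add: add.assoc)
qed

lemma box_polys_monomial_mult: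
  assumes "q \<in> box_polys I m" "\<And>i. i \<in> I \<Longrightarrow> a i \<le> n"
  shows "(\<lambda>x. c * monomial I a x * q x) \<in> box_polys I (n + m)"
  using assms(1)
proof induction
  case zero
  then show ?case using box_polys.zero by simp
next
  case (step b q d)
  have "(\<lambda>x. (c * d) * monomial I (\<lambda>i. a i + b i) x + c * monomial I a x * q x) \<in> box_polys I (n + m)"
    using step assms(2) by (intro box_polys.step) (auto intro: add_mono)
  then show ?case by (simp add: monomial_mult[symmetric] algebra_simps)
qed

lemma box_polys_mult:
  assumes "p \<in> box_polys I n" "q \<in> box_polys I m"
  shows "(\<lambda>x. p x * q x) \<in> box_polys I (n + m)"
  using assms(1)
proof induction
  case zero
  then show ?case using box_polys.zero by simp
next
  case (step a p c)
  then show ?case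
    using box_polys_add[OF box_polys_monomial_mult[OF assms(2), of a n c] step(3)]
    by (simp add: distrib_right)
qed

lemma box_polys_1: "(\<lambda>x. 1) \<in> box_polys I n"
  using box_polys.step[OF _ box_polys.zero, of I "\<lambda>_. 0" n 1] by (simp add: monomial_def)

lemma box_polys_power:
  assumes "p \<in> box_polys I n"
  shows "(\<lambda>x. p x ^ b) \<in> box_polys I (b * n)"
proof (induction b)
  case 0
  show ?case using box_polys_1 by simp
next
  case (Suc b)
  then show ?case using box_polys_mult[OF assms Suc] by simp
qed

lemma box_polys_prod:
  assumes "\<And>d. d \<in> D \<Longrightarrow> f d \<in> box_polys I n"
  shows "(\<lambda>x. \<Prod>d\<in>D. f d x) \<in> box_polys I (card D * n)"
  using assms
proof (induction D rule: infinite_finite_induct)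
  case (insert d D)
  then have "(\<lambda>x. f d x * (\<Prod>d\<in>D. f d x)) \<in> box_polys I (n + card D * n)"
    by (intro box_polys_mult) auto
  then show ?case using insert.hyps by (simp cong: prod.cong)
qed (use box_polys_1 in auto)

lemma poly_funs_box:
  fixes p :: "('i \<Rightarrow> 'k::comm_ring_1) \<Rightarrow> 'k"
  assumes "finite I" "p \<in> poly_funs I"
  shows "\<exists>n. p \<in> box_polys I n"
  using assms(2)
proof induction
  case (const c)
  show ?case
    using box_polys.step[OF _ box_polys.zero, of I "\<lambda>_. 0" 0 c] by (auto simp: monomial_def)
next
  case (coord i)
  let ?a = "\<lambda>j. if j = i then 1 else 0 :: nat"
  have "monomial I ?a = (\<lambda>x :: 'i \<Rightarrow> 'k. x i)"
    using coord assms(1) unfolding monomial_def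
    by (simp add: if_distrib[of "\<lambda>e. _ ^ e"] cong: if_cong)
  moreover have "(\<lambda>x :: 'i \<Rightarrow> 'k. 1 * monomial I ?a x + 0) \<in> box_polys I 1"
    by (intro box_polys.step box_polys.zero) auto
  ultimately show ?case by auto
next
  case (add p q)
  then obtain n m where "p \<in> box_polys I n" "q \<in> box_polys I m" by blast
  then show ?case
    using box_polys_add[of p I "max n m" q] box_polys_mono by (metis max.cobounded1 max.cobounded2)
next
  case (mult p q)
  then show ?case using box_polys_mult by blast
qed

text \<open>Exponents outside \<open>I\<close> do not affect a monomial, so each term can be filed
  under its restricted exponent function and repeated terms merge into one coefficient.\<close>

lemma box_polys_expand:
  assumes "finite I" "p \<in> box_polys I n"
  shows "\<exists>c. \<forall>x. p x = (\<Sum>a\<in>I \<rightarrow>\<^sub>E {..n}. c a * monomial I a x)"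
  using assms(2)
proof induction
  case zero
  show ?case by (rule exI[of _ "\<lambda>_. 0"]) simp
next
  case (step a p k)
  then obtain c where c: "\<forall>x. p x = (\<Sum>a\<in>I \<rightarrow>\<^sub>E {..n}. c a * monomial I a x)" by blast
  let ?r = "restrict a I"
  have r: "?r \<in> I \<rightarrow>\<^sub>E {..n}" using step by auto
  have fin: "finite (I \<rightarrow>\<^sub>E {..n})" using assms(1) by (simp add: finite_PiE)
  have "k * monomial I a x + p x
      = (\<Sum>b\<in>I \<rightarrow>\<^sub>E {..n}. (c b + (if b = ?r then k else 0)) * monomial I b x)" for x
    using r fin c by (simp add: distrib_right sum.distrib if_distrib[of "\<lambda>z. z * _"] monomial_restrict
        cong: if_cong)
  then show ?case by (intro exI[of _ "\<lambda>b. c b + (if b = ?r then k else 0)"]) blast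
qed

text \<open>Grouping by the power of the variable \<open>d\<close> gives a univariate polynomial
  that vanishes for all \<open>t\<close>; its coefficients are therefore zero and fall to the
  induction hypothesis.\<close>

lemma monomials_independent:
  fixes u :: "('i \<Rightarrow> nat) \<Rightarrow> 'k::real_normed_field"
  assumes "finite D" "\<And>y. (\<Sum>b\<in>D \<rightarrow>\<^sub>E {..B}. u b * monomial D b y) = 0" "b \<in> D \<rightarrow>\<^sub>E {..B}"
  shows "u b = 0"
  using assms
proof (induction D arbitrary: u b rule: finite_induct)
  case empty
  then show ?case by (simp add: monomial_def)
next
  case (insert d D)
  let ?P = "D \<rightarrow>\<^sub>E {..B}"
  have finP: "finite ?P" using insert.hyps by (simp add: finite_PiE)
  have expand: "(\<Sum>b\<in>insert d D \<rightarrow>\<^sub>E {..B}. u b * monomial (insert d D) b (y(d := t)))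
     = (\<Sum>e\<le>B. (\<Sum>b\<in>?P. u (b(d := e)) * monomial D b y) * t ^ e)" for y t
  proof -
    have inj: "inj_on (\<lambda>(e, b). b(d := e)) ({..B} \<times> ?P)"
      using insert.hyps(2) by (auto simp: inj_on_def PiE_def extensional_def fun_eq_iff)
    have mono: "monomial (insert d D) (b(d := e)) (y(d := t)) = monomial D b y * t ^ e" for b e
    proof -
      have "(\<Prod>i\<in>D. (y(d := t)) i ^ (b(d := e)) i) = (\<Prod>i\<in>D. y i ^ b i)"
        using insert.hyps(2) by (intro prod.cong) auto
      then show ?thesis using insert.hyps unfolding monomial_def by (simp add: mult.commute)
    qed
    have "(\<Sum>b\<in>insert d D \<rightarrow>\<^sub>E {..B}. u b * monomial (insert d D) b (y(d := t)))
      = (\<Sum>(e, b)\<in>{..B} \<times> ?P. u (b(d := e)) * monomial (insert d D) (b(d := e)) (y(d := t)))"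
      unfolding PiE_insert_eq by (subst sum.reindex[OF inj]) (simp add: case_prod_unfold)
    also have "\<dots> = (\<Sum>e\<le>B. \<Sum>b\<in>?P. u (b(d := e)) * (monomial D b y * t ^ e))"
      unfolding mono by (simp add: sum.cartesian_product)
    finally show ?thesis by (simp add: sum_distrib_right mult.assoc)
  qed
  have "(\<Sum>b\<in>?P. u (b(d := e)) * monomial D b y) = 0" if "e \<le> B" for e y
  proof -
    have "\<forall>t. (\<Sum>e\<le>B. (\<Sum>b\<in>?P. u (b(d := e)) * monomial D b y) * t ^ e) = 0"
      using insert.prems(1) expand by metis
    then show ?thesis using that unfolding Transcendental.polyfun_eq_0 by blast
  qed
  then have z: "u (b'(d := e)) = 0" if "e \<le> B" "b' \<in> ?P" for e b'
    using insert.IH[of "\<lambda>b. u (b(d := e))" b'] that by blast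
  obtain e b' where "e \<le> B" "b' \<in> ?P" "b = b'(d := e)"
    using insert.prems(2) unfolding PiE_insert_eq by auto
  then show ?case using z by blast
qed

section \<open>Algebraic independence and the number of variables\<close>

text \<open>Relations are polynomial functions instead of formal polynomials; over an infinite field
  the two notions agree.\<close>

definition alg_indep :: "'d set \<Rightarrow> ('d \<Rightarrow> ('i \<Rightarrow> 'k::comm_ring_1) \<Rightarrow> 'k) \<Rightarrow> bool" where
  "alg_indep D f \<longleftrightarrow> (\<forall>q\<in>poly_funs D. (\<forall>x. q (\<lambda>d. f d x) = 0) \<longrightarrow> (\<forall>y. q y = 0))"

text \<open>Products of the \<open>f d\<close> with exponents at most \<open>N\<close> number \<open>(N + 1) ^ card D\<close>, but they live
  in a space of dimension \<open>O(N ^ card I)\<close>.\<close>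

lemma alg_indep_card_le:
  fixes f :: "'d \<Rightarrow> ('i \<Rightarrow> 'k::real_normed_field) \<Rightarrow> 'k"
  assumes "finite I" "finite D" "\<And>d. d \<in> D \<Longrightarrow> f d \<in> poly_funs I" "alg_indep D f"
  shows "card D \<le> card I"
proof (rule ccontr)
  assume "\<not> ?thesis"
  then have less: "card I < card D" by simp
  have "\<forall>d\<in>D. \<exists>n. f d \<in> box_polys I n" using poly_funs_box[OF assms(1)] assms(3) by blast
  then obtain g where g: "\<And>d. d \<in> D \<Longrightarrow> f d \<in> box_polys I (g d)" by metis
  define n where "n = (\<Sum>d\<in>D. g d)"
  have n: "f d \<in> box_polys I n" if "d \<in> D" for d
    using box_polys_mono[OF g[OF that]] that assms(2) unfolding n_def by (simp add: member_le_sum)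
  \<comment> \<open>The products have exponents at most \<open>E\<close>, and
    \<open>E + 1 \<le> K * (N + 1)\<close>. Taking \<open>N = K ^ card I\<close> lets the constant
    \<open>K ^ card I\<close> be absorbed by a single further factor \<open>N + 1\<close>, which the
    inequality \<open>card I < card D\<close> supplies.\<close>
  define K where "K = card D * n + 1"
  define N where "N = K ^ card I"
  define E where "E = card D * (N * n)"
  have prod_box: "(\<lambda>x. monomial D b (\<lambda>d. f d x)) \<in> box_polys I E" if "b \<in> D \<rightarrow>\<^sub>E {..N}" for b
    unfolding monomial_def E_def
  proof (rule box_polys_prod)
    fix d assume "d \<in> D"
    then have "b d \<le> N" using that by auto
    then show "(\<lambda>x. f d x ^ b d) \<in> box_polys I (N * n)"
      using box_polys_mono[OF box_polys_power[OF n[OF \<open>d \<in> D\<close>], of "b d"]] by simp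
  qed
  then have "\<forall>b\<in>D \<rightarrow>\<^sub>E {..N}. \<exists>c. \<forall>x. monomial D b (\<lambda>d. f d x)
      = (\<Sum>a\<in>I \<rightarrow>\<^sub>E {..E}. c a * monomial I a x)"
    using box_polys_expand[OF assms(1)] by blast
  then obtain c where c: "\<And>b x. b \<in> D \<rightarrow>\<^sub>E {..N} \<Longrightarrow> monomial D b (\<lambda>d. f d x)
      = (\<Sum>a\<in>I \<rightarrow>\<^sub>E {..E}. c b a * monomial I a x)"
    by metis
  have "E + 1 \<le> K * (N + 1)" unfolding E_def K_def by (simp add: algebra_simps)
  then have "(E + 1) ^ card I \<le> (K * (N + 1)) ^ card I" by (rule power_mono) simp
  also have "\<dots> = N * (N + 1) ^ card I" by (simp only: N_def power_mult_distrib)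
  also have "\<dots> < (N + 1) ^ Suc (card I)" by simp
  also have "\<dots> \<le> (N + 1) ^ card D" using less by (intro power_increasing) auto
  finally have "card (I \<rightarrow>\<^sub>E {..E}) < card (D \<rightarrow>\<^sub>E {..N})"
    using assms(1,2) by (simp add: card_PiE)
  moreover have "finite (I \<rightarrow>\<^sub>E {..E})" "finite (D \<rightarrow>\<^sub>E {..N})"
    using assms(1,2) by (simp_all add: finite_PiE)
  \<comment> \<open>One equation per monomial in the variables of \<open>I\<close>, one unknown per
    product of the \<open>f d\<close>: a nontrivial solution is a polynomial relation among the
    \<open>f d\<close>.\<close>
  ultimately obtain u where u: "\<exists>b\<in>D \<rightarrow>\<^sub>E {..N}. u b \<noteq> 0"
    "\<forall>a\<in>I \<rightarrow>\<^sub>E {..E}. (\<Sum>b\<in>D \<rightarrow>\<^sub>E {..N}. c b a * u b) = 0"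
    using homogeneous_system[of "I \<rightarrow>\<^sub>E {..E}" "D \<rightarrow>\<^sub>E {..N}" "\<lambda>a b. c b a"] by blast
  define q where "q = (\<lambda>y. \<Sum>b\<in>D \<rightarrow>\<^sub>E {..N}. u b * monomial D b y)"
  have q: "q \<in> poly_funs D"
    unfolding q_def by (intro poly_funs_sum poly_funs.mult poly_funs.const monomial_poly_funs)
  have "q (\<lambda>d. f d x) = 0" for x
  proof -
    have "q (\<lambda>d. f d x) = (\<Sum>b\<in>D \<rightarrow>\<^sub>E {..N}. \<Sum>a\<in>I \<rightarrow>\<^sub>E {..E}. u b * (c b a * monomial I a x))"
      unfolding q_def by (intro sum.cong) (simp_all add: c sum_distrib_left)
    also have "\<dots> = (\<Sum>a\<in>I \<rightarrow>\<^sub>E {..E}. (\<Sum>b\<in>D \<rightarrow>\<^sub>E {..N}. c b a * u b) * monomial I a x)"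
      by (subst sum.swap) (simp add: sum_distrib_left sum_distrib_right mult_ac)
    also have "\<dots> = 0" using u(2) by simp
    finally show ?thesis .
  qed
  then have "q y = 0" for y using assms(4) q unfolding alg_indep_def by blast
  then have "u b = 0" if "b \<in> D \<rightarrow>\<^sub>E {..N}" for b
    using monomials_independent[OF assms(2), where B = N and u = u and b = b] that unfolding q_def by blast
  then show False using u(1) by blast
qed

section \<open>Krull dimension of affine space\<close>

lemma topspace_zariski: "topspace (zariski I :: ('i \<Rightarrow> 'k::field) topology) = I \<rightarrow>\<^sub>E UNIV"
proof -
  have "(I \<rightarrow>\<^sub>E UNIV) = {x \<in> I \<rightarrow>\<^sub>E UNIV. (\<lambda>x. 1 :: 'k) x \<noteq> 0}" by simp
  then show ?thesis
    unfolding zariski_def topology_generated_by_topspace using poly_funs.const[of "1 :: 'k" I] by blast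
qed

text \<open>The generating sets form a basis, because the product of two polynomials is nonzero
  exactly on the intersection of their nonvanishing sets.\<close>

lemma zariski_open_basis:
  fixes W :: "('i \<Rightarrow> 'k::field) set"
  assumes "openin (zariski I) W" "x \<in> W"
  obtains p where "p \<in> poly_funs I" "p x \<noteq> 0" "\<And>y. y \<in> I \<rightarrow>\<^sub>E UNIV \<Longrightarrow> p y \<noteq> 0 \<Longrightarrow> y \<in> W"
proof -
  have "generate_topology_on ((\<lambda>p. {x \<in> I \<rightarrow>\<^sub>E UNIV. p x \<noteq> 0}) ` poly_funs I) W"
    using assms(1) unfolding zariski_def by (rule openin_topology_generated_by)
  then have "x \<in> W \<Longrightarrow> \<exists>p\<in>poly_funs I. p x \<noteq> 0 \<and> (\<forall>y\<in>I \<rightarrow>\<^sub>E UNIV. p y \<noteq> 0 \<longrightarrow> y \<in> W)"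
  proof induction
    case (Int a b)
    then obtain p q where "p \<in> poly_funs I" "p x \<noteq> 0" "\<forall>y\<in>I \<rightarrow>\<^sub>E UNIV. p y \<noteq> 0 \<longrightarrow> y \<in> a"
      "q \<in> poly_funs I" "q x \<noteq> 0" "\<forall>y\<in>I \<rightarrow>\<^sub>E UNIV. q y \<noteq> 0 \<longrightarrow> y \<in> b" by auto
    then show ?case by (intro bexI[of _ "\<lambda>x. p x * q x"]) (auto intro: poly_funs.mult)
  next
    case (UN K)
    then obtain k where k: "k \<in> K" "x \<in> k" by blast
    then obtain p where "p \<in> poly_funs I" "p x \<noteq> 0" "\<forall>y\<in>I \<rightarrow>\<^sub>E UNIV. p y \<noteq> 0 \<longrightarrow> y \<in> k"
      using UN.IH[OF k] by auto
    then show ?case using k(1) by (intro bexI[of _ p]) auto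
  next
    case (Basis s)
    then obtain p where "p \<in> poly_funs I" "s = {x \<in> I \<rightarrow>\<^sub>E UNIV. p x \<noteq> 0}" by blast
    then show ?case using Basis.prems by (intro bexI[of _ p]) auto
  qed simp
  then show thesis using assms(2) that by blast
qed

lemma zariski_closed:
  fixes Q :: "(('i \<Rightarrow> 'k::field) \<Rightarrow> 'k) set"
  assumes "Q \<subseteq> poly_funs I"
  shows "closedin (zariski I) {x \<in> I \<rightarrow>\<^sub>E UNIV. \<forall>p\<in>Q. p x = 0}"
proof -
  have "openin (zariski I) {x \<in> I \<rightarrow>\<^sub>E UNIV. p x \<noteq> 0}" if "p \<in> Q" for p
    unfolding zariski_def using that assms by (intro topology_generated_by_Basis) auto
  then have "openin (zariski I) (\<Union>p\<in>Q. {x \<in> I \<rightarrow>\<^sub>E UNIV. p x \<noteq> 0})" by blast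
  moreover have "(I \<rightarrow>\<^sub>E UNIV) - {x \<in> I \<rightarrow>\<^sub>E UNIV. \<forall>p\<in>Q. p x = 0}
      = (\<Union>p\<in>Q. {x \<in> I \<rightarrow>\<^sub>E UNIV. p x \<noteq> 0})" by auto
  ultimately show ?thesis unfolding closedin_def topspace_zariski by auto
qed

lemma zariski_closed_separate:
  fixes Z :: "('i \<Rightarrow> 'k::field) set"
  assumes "closedin (zariski I) Z" "x \<in> I \<rightarrow>\<^sub>E UNIV" "x \<notin> Z"
  obtains p where "p \<in> poly_funs I" "p x \<noteq> 0" "\<And>y. y \<in> Z \<Longrightarrow> p y = 0"
proof -
  have "openin (zariski I) ((I \<rightarrow>\<^sub>E UNIV) - Z)" "Z \<subseteq> I \<rightarrow>\<^sub>E UNIV"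
    using assms(1) by (auto simp: closedin_def topspace_zariski)
  moreover have "x \<in> (I \<rightarrow>\<^sub>E UNIV) - Z" using assms by simp
  ultimately obtain p where "p \<in> poly_funs I" "p x \<noteq> 0"
    "\<And>y. y \<in> I \<rightarrow>\<^sub>E UNIV \<Longrightarrow> p y \<noteq> 0 \<Longrightarrow> y \<in> (I \<rightarrow>\<^sub>E UNIV) - Z"
    using zariski_open_basis by blast
  then show thesis using \<open>Z \<subseteq> I \<rightarrow>\<^sub>E UNIV\<close> by (intro that[of p]) auto
qed

text \<open>A point outside the closure is separated from it by a polynomial, and conversely the
  zero set of a polynomial vanishing on \<open>S\<close> is a closed set containing
  \<open>S\<close>.\<close>

lemma zariski_closure_eq_topspace_iff:
  fixes S :: "('i \<Rightarrow> 'k::field) set"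
  assumes "S \<subseteq> I \<rightarrow>\<^sub>E UNIV"
  shows "zariski I closure_of S = topspace (zariski I) \<longleftrightarrow>
    (\<forall>p\<in>poly_funs I. (\<forall>x\<in>S. p x = 0) \<longrightarrow> (\<forall>x. p x = 0))" (is "?L \<longleftrightarrow> ?R")
proof
  assume L: ?L
  show ?R
  proof (intro ballI impI allI)
    fix p x assume p: "p \<in> poly_funs I" "\<forall>x\<in>S. p x = 0"
    have "zariski I closure_of S \<subseteq> {x \<in> I \<rightarrow>\<^sub>E UNIV. \<forall>p\<in>{p}. p x = 0}"
      by (rule closure_of_minimal[OF _ zariski_closed]) (use p assms in auto)
    moreover have "restrict x I \<in> zariski I closure_of S" using L unfolding topspace_zariski by auto
    ultimately have "p (restrict x I) = 0" by auto
    then show "p x = 0" using poly_funs_restrict[OF p(1), of x] by simp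
  qed
next
  assume R: ?R
  show ?L
  proof (rule ccontr)
    assume "\<not> ?L"
    then obtain x where x: "x \<in> I \<rightarrow>\<^sub>E UNIV" "x \<notin> zariski I closure_of S"
      using closure_of_subset_topspace[of "zariski I" S] unfolding topspace_zariski by blast
    obtain p where p: "p \<in> poly_funs I" "p x \<noteq> 0" "\<And>y. y \<in> zariski I closure_of S \<Longrightarrow> p y = 0"
      using zariski_closed_separate[OF closedin_closure_of x] by auto
    have "S \<subseteq> zariski I closure_of S" using assms by (simp add: closure_of_subset topspace_zariski)
    then show False using R p by blast
  qed
qed

section \<open>Irreducible sets, chains and dimension\<close>

text \<open>If \<open>x\<close> avoids \<open>A\<close> and \<open>y\<close> avoids
  \<open>B\<close>, separating polynomials are simultaneously nonzero somewhere on the line through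
  \<open>x\<close> and \<open>y\<close>. This covers affine space and its coordinate
  subspaces.\<close>

lemma irreducible_in_zariski_lines:
  fixes Z :: "('i \<Rightarrow> 'k::field_char_0) set"
  assumes "Z \<subseteq> I \<rightarrow>\<^sub>E UNIV" "Z \<noteq> {}"
    and line: "\<And>x y t. x \<in> Z \<Longrightarrow> y \<in> Z \<Longrightarrow> (\<lambda>i\<in>I. x i + t * (y i - x i)) \<in> Z"
  shows "irreducible_in (zariski I) Z"
  unfolding irreducible_in_def
proof (intro conjI allI impI)
  fix A B assume AB: "closedin (zariski I) A \<and> closedin (zariski I) B \<and> Z \<subseteq> A \<union> B"
  show "Z \<subseteq> A \<or> Z \<subseteq> B"
  proof (rule ccontr)
    assume "\<not> ?thesis"
    then obtain x y where xy: "x \<in> Z" "x \<notin> A" "y \<in> Z" "y \<notin> B" by blast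
    then have xyI: "x \<in> I \<rightarrow>\<^sub>E UNIV" "y \<in> I \<rightarrow>\<^sub>E UNIV" using assms(1) by auto
    obtain p where p: "p \<in> poly_funs I" "p x \<noteq> 0" "\<And>z. z \<in> A \<Longrightarrow> p z = 0"
      using zariski_closed_separate[OF _ xyI(1) xy(2)] AB by auto
    obtain q where q: "q \<in> poly_funs I" "q y \<noteq> 0" "\<And>z. z \<in> B \<Longrightarrow> q z = 0"
      using zariski_closed_separate[OF _ xyI(2) xy(4)] AB by auto
    obtain t where t: "p (\<lambda>i. x i + t * (y i - x i)) \<noteq> 0" "q (\<lambda>i. x i + t * (y i - x i)) \<noteq> 0"
      using poly_funs_line_common_nonzero[OF p(1) q(1), of x 0 "\<lambda>i. y i - x i" 1] p(2) q(2) by auto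
    let ?z = "\<lambda>i\<in>I. x i + t * (y i - x i)"
    have "p ?z \<noteq> 0" "q ?z \<noteq> 0" using t by (simp_all add: poly_funs_restrict[OF p(1)] poly_funs_restrict[OF q(1)])
    moreover have "?z \<in> A \<union> B" using line[OF xy(1,3)] AB by blast
    ultimately show False using p(3) q(3) by blast
  qed
qed (use assms in \<open>auto simp: topspace_zariski\<close>)

definition irreducible_chain :: "'a topology \<Rightarrow> (nat \<Rightarrow> 'a set) \<Rightarrow> nat \<Rightarrow> bool" where
  "irreducible_chain X Z n \<longleftrightarrow>
     (\<forall>i\<le>n. closedin X (Z i) \<and> irreducible_in X (Z i)) \<and> (\<forall>i<n. Z i \<subset> Z (Suc i))"

lemma krull_dim_chain: "krull_dim X = Sup {enat n | n. \<exists>Z. irreducible_chain X Z n}"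
  unfolding krull_dim_def irreducible_chain_def ..

text \<open>The vanishing ideal of an irreducible set is prime: the zero sets of \<open>p\<close>
  and \<open>q\<close> cover \<open>Z\<close>, and the first does not contain it.\<close>

lemma irreducible_in_mult_eq_0:
  fixes Z :: "('i \<Rightarrow> 'k::field) set"
  assumes "irreducible_in (zariski I) Z" "p \<in> poly_funs I" "q \<in> poly_funs I"
    "\<And>x. x \<in> Z \<Longrightarrow> p x * q x = 0" "z \<in> Z" "p z \<noteq> 0" "x \<in> Z"
  shows "q x = 0"
proof -
  let ?A = "{x \<in> I \<rightarrow>\<^sub>E UNIV. \<forall>p\<in>{p}. p x = 0}" and ?B = "{x \<in> I \<rightarrow>\<^sub>E UNIV. \<forall>p\<in>{q}. p x = 0}"
  have "closedin (zariski I) ?A" "closedin (zariski I) ?B"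
    using assms by (auto intro!: zariski_closed simp del: ball_simps)
  moreover have "Z \<subseteq> ?A \<union> ?B"
    using assms(1,4) unfolding irreducible_in_def topspace_zariski by auto
  moreover have "Z \<subseteq> A \<or> Z \<subseteq> B"
    if "closedin (zariski I) A" "closedin (zariski I) B" "Z \<subseteq> A \<union> B" for A B
    using assms(1) that unfolding irreducible_in_def by blast
  ultimately have "Z \<subseteq> ?A \<or> Z \<subseteq> ?B" by presburger
  then show ?thesis using assms(5-7) by auto
qed

text \<open>If \<open>f k\<close> vanishes on \<open>Z k\<close> but not on \<open>Z (Suc k)\<close>, then \<open>f 0, \<dots>, f (n - 1)\<close> are algebraically
  independent: cancelling the largest possible power of the last variable from a relation and
  restricting to \<open>Z k\<close> leaves a relation in one variable less.\<close>

lemma irreducible_chain_length: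
  fixes Z :: "nat \<Rightarrow> ('i \<Rightarrow> 'k::real_normed_field) set"
  assumes "finite I" "irreducible_chain (zariski I) Z n"
  shows "n \<le> card I"
proof -
  have irr: "irreducible_in (zariski I) (Z i)" "closedin (zariski I) (Z i)" if "i \<le> n" for i
    using assms(2) that unfolding irreducible_chain_def by auto
  have "\<forall>k<n. \<exists>p. p \<in> poly_funs I \<and> (\<forall>x\<in>Z k. p x = 0) \<and> (\<exists>x\<in>Z (Suc k). p x \<noteq> 0)"
  proof (intro allI impI)
    fix k assume k: "k < n"
    then obtain x where x: "x \<in> Z (Suc k)" "x \<notin> Z k"
      using assms(2) unfolding irreducible_chain_def by blast
    then have xI: "x \<in> I \<rightarrow>\<^sub>E UNIV"
      using irr(1)[of "Suc k"] k unfolding irreducible_in_def topspace_zariski by auto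
    obtain p where "p \<in> poly_funs I" "p x \<noteq> 0" "\<And>y. y \<in> Z k \<Longrightarrow> p y = 0"
      using zariski_closed_separate[OF irr(2)[of k] xI x(2)] k by auto
    then show "\<exists>p. p \<in> poly_funs I \<and> (\<forall>x\<in>Z k. p x = 0) \<and> (\<exists>x\<in>Z (Suc k). p x \<noteq> 0)"
      using x(1) by (intro exI[of _ p]) auto
  qed
  then obtain f where f: "\<And>k. k < n \<Longrightarrow> f k \<in> poly_funs I"
    "\<And>k x. k < n \<Longrightarrow> x \<in> Z k \<Longrightarrow> f k x = 0" "\<And>k. k < n \<Longrightarrow> \<exists>x\<in>Z (Suc k). f k x \<noteq> 0"
    by metis
  have indep: "q y = 0" if "k \<le> n" "q \<in> poly_funs {..<k}" "\<And>x. x \<in> Z k \<Longrightarrow> q (\<lambda>d. f d x) = 0" for k q y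
    using that
  proof (induction k arbitrary: q y)
    case 0
    obtain x where "x \<in> Z 0" using irr(1)[of 0] unfolding irreducible_in_def by auto
    then have "q (\<lambda>d. f d x) = 0" using 0 by blast
    then show ?case using poly_funs_cong[OF 0(2), of "\<lambda>d. f d x" y] by simp
  next
    case (Suc k)
    have k: "k < n" using Suc.prems by simp
    have "{..<Suc k} = insert k {..<k}" by auto
    then obtain d c where c: "\<And>e. c e \<in> poly_funs {..<k}" "\<And>x. q x = (\<Sum>e\<le>d. c e x * x k ^ e)"
      "\<And>e. e > d \<Longrightarrow> c e = (\<lambda>x. 0)"
      using poly_funs_insert_expand[of q k "{..<k}"] Suc.prems(2) by metis
    have "c e y = 0" if "e \<le> d" for e y
      using that
    proof (induction e arbitrary: y rule: less_induct)
      case (less e)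
      \<comment> \<open>The coefficients below \<open>e\<close> vanish by the inner induction, so
        \<open>h\<close> is \<open>q\<close> divided by the \<open>e\<close>-th power of the last
        variable.\<close>
      define h where "h = (\<lambda>x. \<Sum>j\<le>d - e. c (j + e) x * x k ^ j)"
      have qh: "q x = x k ^ e * h x" for x
      proof -
        have "q x = (\<Sum>j\<in>{e..d}. c j x * x k ^ j)"
          unfolding c(2) by (rule sum.mono_neutral_right) (use less.IH in auto)
        also have "\<dots> = (\<Sum>j\<in>{0 + e..(d - e) + e}. c j x * x k ^ j)" using less.prems by simp
        also have "\<dots> = (\<Sum>j\<le>d - e. c (j + e) x * x k ^ (j + e))"
          by (subst sum.shift_bounds_cl_nat_ivl) (simp add: atLeast0AtMost)
        finally show ?thesis unfolding h_def by (simp add: sum_distrib_left power_add mult_ac)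
      qed
      have hp: "h \<in> poly_funs {..<Suc k}"
        unfolding h_def
        by (intro poly_funs_sum poly_funs.mult poly_funs_power poly_funs.coord poly_funs_mono[OF c(1)]) auto
      have fp: "(\<lambda>x. h (\<lambda>d. f d x)) \<in> poly_funs I"
        by (rule poly_funs_compose[OF hp]) (use k f(1) in auto)
      obtain z where z: "z \<in> Z (Suc k)" "f k z \<noteq> 0" using f(3)[OF k] by blast
      \<comment> \<open>Irreducibility of \<open>Z (Suc k)\<close> cancels the factor
        \<open>f k ^ e\<close>, as \<open>f k\<close> is nonzero at \<open>z\<close>.\<close>
      have h0: "h (\<lambda>d. f d x) = 0" if "x \<in> Z (Suc k)" for x
        using irreducible_in_mult_eq_0[OF irr(1) poly_funs_power[OF f(1)[OF k], of e] fp _ z(1) _ that]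
          k z(2) Suc.prems(3) qh by simp
      \<comment> \<open>On \<open>Z k\<close> the last variable \<open>f k\<close> is zero, so only
        the constant term of \<open>h\<close> survives.\<close>
      have ce: "c e (\<lambda>d. f d x) = 0" if "x \<in> Z k" for x
      proof -
        have "x \<in> Z (Suc k)" using that assms(2) k unfolding irreducible_chain_def by blast
        then have "h (\<lambda>d. f d x) = 0" by (rule h0)
        moreover have "h (\<lambda>d. f d x) = c e (\<lambda>d. f d x)"
          unfolding h_def using f(2)[OF k that]
          by (simp add: sum.remove[of "{..d - e}" 0] power_0_left)
        ultimately show ?thesis by simp
      qed
      show ?case by (rule Suc.IH[OF less_imp_le[OF k] c(1) ce])
    qed
    then show ?case unfolding c(2) by simp
  qed
  have "alg_indep {..<n} f" unfolding alg_indep_def using indep[of n] by auto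
  then show ?thesis using alg_indep_card_le[OF assms(1), of "{..<n}" f] f(1) by simp
qed

text \<open>The flag of coordinate subspaces: in \<open>Z m\<close> all coordinates numbered
  \<open>m\<close> or higher vanish, so the chain runs from the origin to the whole space.\<close>

lemma coordinate_flag:
  fixes I :: "'i set"
  assumes "finite I"
  shows "\<exists>Z. irreducible_chain (zariski I :: ('i \<Rightarrow> 'k::field_char_0) topology) Z (card I)"
proof -
  obtain g where g: "bij_betw g {0..<card I} I" using ex_bij_betw_nat_finite[OF assms] by blast
  define Z :: "nat \<Rightarrow> ('i \<Rightarrow> 'k) set" where
    "Z m = {x \<in> I \<rightarrow>\<^sub>E UNIV. \<forall>p\<in>(\<lambda>j x. x (g j)) ` {m..<card I}. p x = 0}" for m
  have gI: "g j \<in> I" if "j < card I" for j using bij_betwE[OF g] that by simp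
  have "irreducible_in (zariski I) (Z m)" for m
  proof (rule irreducible_in_zariski_lines)
    show "Z m \<noteq> {}" using gI by (auto simp: Z_def intro!: exI[of _ "\<lambda>i\<in>I. 0"])
  qed (use gI in \<open>auto simp: Z_def\<close>)
  moreover have "closedin (zariski I) (Z m)" for m
    unfolding Z_def by (rule zariski_closed) (use gI in \<open>auto intro: poly_funs.coord\<close>)
  moreover have "Z m \<subset> Z (Suc m)" if m: "m < card I" for m
  proof -
    define x where "x = (\<lambda>i\<in>I. if i = g m then 1 else 0 :: 'k)"
    have "g j \<noteq> g m" if "Suc m \<le> j" "j < card I" for j
      using bij_betw_imp_inj_on[OF g] that m by (metis atLeastLessThan_iff inj_onD le_imp_less_Suc lessI less_irrefl less_le_trans zero_le)
    then have "x \<in> Z (Suc m)" using gI by (auto simp: Z_def x_def)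
    moreover have "x \<notin> Z m" using gI[OF m] m by (auto simp: Z_def x_def)
    moreover have "Z m \<subseteq> Z (Suc m)" by (auto simp: Z_def)
    ultimately show ?thesis by blast
  qed
  ultimately show ?thesis unfolding irreducible_chain_def by blast
qed

text \<open>Lets a chain inside a closed subspace be read as a chain of the ambient space.\<close>

lemma irreducible_in_subtopology_closed:
  assumes "closedin X C" "irreducible_in (subtopology X C) Z"
  shows "irreducible_in X Z"
  unfolding irreducible_in_def
proof (intro conjI allI impI)
  have ZC: "Z \<subseteq> C" "Z \<subseteq> topspace X" using assms(2) unfolding irreducible_in_def by auto
  show "Z \<subseteq> topspace X" by fact
  show "Z \<noteq> {}" using assms(2) unfolding irreducible_in_def by blast
  fix A B assume AB: "closedin X A \<and> closedin X B \<and> Z \<subseteq> A \<union> B"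
  then have "closedin (subtopology X C) (A \<inter> C)" "closedin (subtopology X C) (B \<inter> C)"
    unfolding closedin_subtopology by blast+
  moreover have "Z \<subseteq> (A \<inter> C) \<union> (B \<inter> C)" using AB ZC by blast
  ultimately have "Z \<subseteq> A \<inter> C \<or> Z \<subseteq> B \<inter> C"
    using assms(2) unfolding irreducible_in_def by blast
  then show "Z \<subseteq> A \<or> Z \<subseteq> B" by blast
qed

text \<open>A dense set has the dimension of affine space. If the closure is proper, the irreducible
  whole space can be put on top of any chain in it, so such chains have length below
  \<open>card I\<close>.\<close>

lemma zariski_dim_eq_card_iff:
  fixes S :: "('i \<Rightarrow> 'k::real_normed_field) set"
  assumes "finite I" "S \<subseteq> I \<rightarrow>\<^sub>E UNIV" "S \<noteq> {}"
  shows "zariski_dim I S = enat (card I) \<longleftrightarrow>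
    (\<forall>p\<in>poly_funs I. (\<forall>x\<in>S. p x = 0) \<longrightarrow> (\<forall>x. p x = 0))" (is "?L \<longleftrightarrow> ?R")
proof
  assume R: ?R
  then have "zariski I closure_of S = topspace (zariski I)"
    using zariski_closure_eq_topspace_iff[OF assms(2)] by blast
  then have dim: "zariski_dim I S = Sup {enat n | n. \<exists>Z. irreducible_chain (zariski I :: ('i \<Rightarrow> 'k) topology) Z n}"
    unfolding zariski_dim_def krull_dim_chain by simp
  show ?L
  proof (rule antisym)
    show "zariski_dim I S \<le> enat (card I)"
      unfolding dim by (rule Sup_least) (use irreducible_chain_length[OF assms(1)] in auto)
    show "enat (card I) \<le> zariski_dim I S"
      unfolding dim by (rule Sup_upper) (use coordinate_flag[OF assms(1)] in auto)
  qed
next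
  assume L: ?L
  let ?C = "zariski I closure_of S"
  show ?R
  proof (rule ccontr)
    assume nR: "\<not> ?R"
    then have ne: "?C \<noteq> topspace (zariski I)"
      using zariski_closure_eq_topspace_iff[OF assms(2)] by blast
    then have C: "?C \<subset> topspace (zariski I)"
      using closure_of_subset_topspace[of "zariski I" S] by auto
    \<comment> \<open>Needed for \<open>card I - 1\<close> to be a strictly smaller natural number.
      Over an empty \<open>I\<close> polynomial functions are constant, and a point of
      \<open>S\<close> decides them.\<close>
    have "I \<noteq> {}"
    proof
      assume "I = {}"
      obtain s where s: "s \<in> S" using assms(3) by blast
      have "p x = 0" if "p \<in> poly_funs I" "\<forall>x\<in>S. p x = 0" for p x
        using that s poly_funs_cong[OF that(1), of s x] \<open>I = {}\<close> by auto
      then show False using nR by auto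
    qed
    then have pos: "card I > 0" using assms(1) by (simp add: card_gt_0_iff)
    have short: "n < card I" if chain: "irreducible_chain (subtopology (zariski I) ?C) Z n" for n Z
    proof -
      define Z' where "Z' = Z(Suc n := topspace (zariski I))"
      have Zi: "closedin (zariski I) (Z i)" "irreducible_in (zariski I) (Z i)" "Z i \<subseteq> ?C" if "i \<le> n" for i
        using chain that irreducible_in_subtopology_closed[OF closedin_closure_of]
          closedin_closed_subtopology[OF closedin_closure_of[of "zariski I" S]]
        unfolding irreducible_chain_def by blast+
      have "irreducible_in (zariski I :: ('i \<Rightarrow> 'k) topology) (topspace (zariski I))"
        unfolding topspace_zariski by (rule irreducible_in_zariski_lines) auto
      moreover have "Z n \<subset> topspace (zariski I)" using Zi(3)[of n] C by blast
      ultimately have "irreducible_chain (zariski I) Z' (Suc n)"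
        using Zi(1,2) chain unfolding irreducible_chain_def Z'_def
        by (auto simp: le_Suc_eq less_Suc_eq)
      then show ?thesis using irreducible_chain_length[OF assms(1), of Z' "Suc n"] by simp
    qed
    have "zariski_dim I S \<le> enat (card I - 1)"
      unfolding zariski_dim_def krull_dim_chain by (rule Sup_least) (use short in fastforce)
    then show False using L pos by simp
  qed
qed

section \<open>From algebraic independence to a generically surjective differential\<close>

section \<open>The Jacobian criterion\<close>

lemma poly_funs_curve_derivative_0:
  fixes q :: "('d \<Rightarrow> real) \<Rightarrow> real"
  assumes "q \<in> poly_funs D" "\<And>d. d \<in> D \<Longrightarrow> ((\<lambda>t. y t d) has_real_derivative 0) (at a)"
  shows "((\<lambda>t. q (y t)) has_real_derivative 0) (at a)"
  using assms(1)
proof induction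
  case (add p q)
  then show ?case using DERIV_add[OF add.IH] by simp
next
  case (mult p q)
  then show ?case using DERIV_mult[OF mult.IH] by simp
qed (use assms(2) in auto)

text \<open>Puts the functions \<open>F\<close> and the coordinate functions into one family, so
  that an independent \<open>F\<close> can be completed by coordinates to a transcendence
  basis.\<close>

definition adjoin_coords ::
    "('c \<Rightarrow> ('i \<Rightarrow> 'k) \<Rightarrow> 'k) \<Rightarrow> 'c + 'i \<Rightarrow> ('i \<Rightarrow> 'k) \<Rightarrow> 'k" where
  "adjoin_coords F = case_sum F (\<lambda>i x. x i)"

lemma alg_indepD:
  assumes "alg_indep D f" "q \<in> poly_funs D" "\<And>x. q (\<lambda>d. f d x) = 0"
  shows "q y = 0"
  using assms unfolding alg_indep_def by auto

lemma alg_indep_adjoin_none: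
  fixes F :: "'c \<Rightarrow> ('i \<Rightarrow> 'k::comm_ring_1) \<Rightarrow> 'k"
  assumes "alg_indep C F"
  shows "alg_indep (C <+> {}) (adjoin_coords F)"
  unfolding alg_indep_def
proof (intro ballI impI allI)
  fix q and y :: "'c + 'i \<Rightarrow> 'k" assume q: "q \<in> poly_funs (C <+> {})" "\<forall>x. q (\<lambda>d. adjoin_coords F d x) = 0"
  let ?h = "\<lambda>k y. case k of Inl c \<Rightarrow> y c | Inr _ \<Rightarrow> 0"
  let ?q = "\<lambda>y. q (\<lambda>k. ?h k y)"
  have qC: "?q \<in> poly_funs C"
    by (rule poly_funs_compose[OF q(1)]) (auto intro: poly_funs.intros)
  have qF: "?q (\<lambda>c. F c x) = 0" for x
  proof -
    have "?q (\<lambda>c. F c x) = q (\<lambda>d. adjoin_coords F d x)"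
      by (rule poly_funs_cong[OF q(1)]) (auto simp: adjoin_coords_def)
    then show ?thesis using q(2) by simp
  qed
  have "?q (\<lambda>c. y (Inl c)) = 0" using alg_indepD[OF assms qC, of "\<lambda>c. y (Inl c)"] qF by blast
  moreover have "?q (\<lambda>c. y (Inl c)) = q y"
    by (rule poly_funs_cong[OF q(1)]) auto
  ultimately show "q y = 0" by simp
qed

text \<open>The factor \<open>g\<close> is the derivative, in the coordinate \<open>i\<close>, of a relation of minimal degree in it;
  the chain rule along \<open>v\<close> leaves only this term.\<close>

lemma algebraic_coordinate:
  fixes F :: "'c \<Rightarrow> ('i \<Rightarrow> real) \<Rightarrow> real"
  assumes F: "\<And>c. c \<in> C \<Longrightarrow> F c \<in> poly_funs I"
    and J: "J \<subseteq> I" "i \<in> I" "alg_indep (C <+> J) (adjoin_coords F)"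
      "\<not> alg_indep (C <+> insert i J) (adjoin_coords F)"
  shows "\<exists>g. g \<in> poly_funs I \<and> (\<exists>x. g x \<noteq> 0) \<and>
    (\<forall>x v. (\<forall>c\<in>C. ((\<lambda>t. F c (\<lambda>i. x i + t * v i)) has_real_derivative 0) (at 0)) \<and>
       (\<forall>j\<in>J. v j = 0) \<longrightarrow> g x * v i = 0)"
proof -
  define fam where "fam = (\<lambda>x d. adjoin_coords F d x)"
  define P where "P = (\<lambda>d. \<exists>c. (\<forall>e. c e \<in> poly_funs (C <+> J)) \<and> (\<exists>e\<le>d. \<exists>y. c e y \<noteq> 0) \<and>
    (\<forall>x. (\<Sum>e\<le>d. c e (fam x) * x i ^ e) = 0))"
  have fam_comp: "(\<lambda>x. q (fam x)) \<in> poly_funs I" if "q \<in> poly_funs (C <+> J)" for q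
    unfolding fam_def
    by (rule poly_funs_compose[OF that]) (use F J(1) in \<open>auto simp: adjoin_coords_def intro!: poly_funs.coord\<close>)
  obtain q y0 where q: "q \<in> poly_funs (C <+> insert i J)" "\<forall>x. q (fam x) = 0" "q y0 \<noteq> 0"
    using J(4) unfolding alg_indep_def fam_def by blast
  have "C <+> insert i J = insert (Inr i) (C <+> J)" by auto
  then obtain d c where c: "\<And>e. c e \<in> poly_funs (C <+> J)"
    "\<And>x. q x = (\<Sum>e\<le>d. c e x * x (Inr i) ^ e)"
    using poly_funs_insert_expand[of q "Inr i" "C <+> J"] q(1) by metis
  have "\<exists>e\<le>d. c e y0 \<noteq> 0"
    using q(3) c(2)[of y0] by (metis (no_types, lifting) atMost_iff mult_zero_left sum.neutral)
  moreover have "(\<Sum>e\<le>d. c e (fam x) * x i ^ e) = 0" for x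
    using q(2) c(2)[of "fam x"] by (simp add: fam_def adjoin_coords_def)
  ultimately have "P d" unfolding P_def using c(1) by blast
  define m where "m = (LEAST d. P d)"
  have "P m" and least: "\<And>d. d < m \<Longrightarrow> \<not> P d"
    unfolding m_def using LeastI[of P d] \<open>P d\<close> not_less_Least by blast+
  then obtain c where c: "\<And>e. c e \<in> poly_funs (C <+> J)" "\<exists>e\<le>m. \<exists>y. c e y \<noteq> 0"
    "\<And>x. (\<Sum>e\<le>m. c e (fam x) * x i ^ e) = 0"
    unfolding P_def by blast
  \<comment> \<open>A relation of degree 0 in the coordinate \<open>i\<close> would be a relation
    among \<open>F\<close> and the coordinates in \<open>J\<close> alone.\<close>
  have "m \<noteq> 0"
  proof
    assume "m = 0"
    then have "\<forall>x. c 0 (fam x) = 0" "\<exists>y. c 0 y \<noteq> 0" using c(2,3) by simp_all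
    then show False using alg_indepD[OF J(3) c(1)[of 0]] unfolding fam_def by auto
  qed
  then obtain n where n: "m = Suc n" using not0_implies_Suc by blast
  have lead: "\<exists>y. c m y \<noteq> 0"
  proof (rule ccontr)
    assume z: "\<not> ?thesis"
    then have "\<exists>e\<le>n. \<exists>y. c e y \<noteq> 0" using c(2) n le_Suc_eq by metis
    moreover have "(\<Sum>e\<le>n. c e (fam x) * x i ^ e) = 0" for x using c(3)[of x] z n by simp
    ultimately have "P n" unfolding P_def using c(1) by blast
    then show False using least n by blast
  qed
  define g where "g = (\<lambda>x. \<Sum>e\<le>n. (real (Suc e) * c (Suc e) (fam x)) * x i ^ e)"
  have "g \<in> poly_funs I"
    unfolding g_def
    by (intro poly_funs_sum poly_funs.mult poly_funs.const fam_comp c(1) poly_funs_power poly_funs.coord J(2))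
  \<comment> \<open>The coefficients of \<open>g\<close> have degree bound \<open>n < m\<close> in
    the coordinate \<open>i\<close>, and the top one is \<open>Suc n\<close> times the nonzero
    \<open>c m\<close>; if \<open>g\<close> vanished identically, minimality of \<open>m\<close>
    would fail.\<close>
  moreover have "\<exists>x. g x \<noteq> 0"
  proof (rule ccontr)
    assume "\<not> ?thesis"
    moreover have "(\<lambda>y. real (Suc e) * c (Suc e) y) \<in> poly_funs (C <+> J)" for e
      by (intro poly_funs.mult poly_funs.const c(1))
    moreover have "\<exists>e\<le>n. \<exists>y. real (Suc e) * c (Suc e) y \<noteq> 0"
      using lead n by (intro exI[of _ n]) auto
    ultimately have "P n" unfolding P_def g_def
      by (intro exI[of _ "\<lambda>e y. real (Suc e) * c (Suc e) y"]) blast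
    then show False using least n by blast
  qed
  moreover have "g x * v i = 0"
    if v: "\<forall>c\<in>C. ((\<lambda>t. F c (\<lambda>i. x i + t * v i)) has_real_derivative 0) (at 0)" "\<forall>j\<in>J. v j = 0" for x v
  proof -
    let ?x = "\<lambda>t i. x i + t * v i"
    \<comment> \<open>The coefficients depend only on the \<open>F c\<close> and the coordinates in
      \<open>J\<close>, all stationary along \<open>v\<close>, so only the powers of the coordinate
      \<open>i\<close> contribute to the derivative.\<close>
    have coef: "((\<lambda>t. c e (fam (?x t))) has_real_derivative 0) (at 0)" for e
      by (rule poly_funs_curve_derivative_0[OF c(1)]) (use v in \<open>auto simp: fam_def adjoin_coords_def\<close>)
    have "((\<lambda>t. \<Sum>e\<le>m. c e (fam (?x t)) * ?x t i ^ e) has_real_derivative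
        (\<Sum>e\<le>m. 0 * ?x 0 i ^ e + (real e * (?x 0 i ^ (e - 1) * v i)) * c e (fam (?x 0)))) (at 0)"
    proof (rule DERIV_sum)
      fix e
      have "((\<lambda>t. ?x t i ^ e) has_real_derivative (real e * (?x 0 i ^ (e - 1) * v i))) (at 0)"
        by (auto intro!: derivative_eq_intros)
      then show "((\<lambda>t. c e (fam (?x t)) * ?x t i ^ e) has_real_derivative
        (0 * ?x 0 i ^ e + (real e * (?x 0 i ^ (e - 1) * v i)) * c e (fam (?x 0)))) (at 0)"
        by (rule DERIV_mult[OF coef])
    qed
    moreover have "((\<lambda>t. \<Sum>e\<le>m. c e (fam (?x t)) * ?x t i ^ e) has_real_derivative 0) (at 0)"
      using c(3)[of "?x _"] by simp
    ultimately have "(\<Sum>e\<le>m. (real e * (x i ^ (e - 1) * v i)) * c e (fam x)) = 0"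
      using DERIV_unique by fastforce
    moreover have "(\<Sum>e\<le>m. (real e * (x i ^ (e - 1) * v i)) * c e (fam x)) = g x * v i"
      unfolding n g_def sum.atMost_Suc_shift by (simp add: sum_distrib_left sum_distrib_right mult_ac)
    ultimately show ?thesis by simp
  qed
  ultimately show ?thesis by blast
qed

text \<open>Complete \<open>F\<close> by a maximal independent set \<open>J\<close> of coordinates.
  Where the product of the \<open>g i\<close> is nonzero, a direction annihilated by the
  differential of \<open>F\<close> and zero on \<open>J\<close> is zero. Since
  \<open>card C + card J \<le> card I\<close>, this injectivity becomes surjectivity by counting
  unknowns.\<close>

lemma jacobian_criterion:
  fixes F :: "'c \<Rightarrow> ('i \<Rightarrow> real) \<Rightarrow> real"
  assumes fin: "finite I" "finite C"
    and F: "\<And>c. c \<in> C \<Longrightarrow> F c \<in> poly_funs I" "alg_indep C F"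
    and deriv: "\<And>c x v. c \<in> C \<Longrightarrow>
      ((\<lambda>t. F c (\<lambda>i. x i + t * v i)) has_real_derivative (\<Sum>i\<in>I. M c x i * v i)) (at 0)"
  obtains p where "p \<in> poly_funs I" "\<exists>x. p x \<noteq> 0"
    "\<And>x w. p x \<noteq> 0 \<Longrightarrow> \<exists>v. \<forall>c\<in>C. (\<Sum>i\<in>I. M c x i * v i) = w c"
proof -
  define \<J> where "\<J> = {J \<in> Pow I. alg_indep (C <+> J) (adjoin_coords F)}"
  have "finite \<J>" "{} \<in> \<J>"
    using fin alg_indep_adjoin_none[OF F(2)] by (auto simp: \<J>_def)
  then obtain J where "J \<in> \<J>" and Jmax: "\<And>K. K \<in> \<J> \<Longrightarrow> J \<subseteq> K \<Longrightarrow> J = K"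
    using finite_has_maximal[of \<J>] by blast
  then have J: "J \<subseteq> I" "alg_indep (C <+> J) (adjoin_coords F)" by (auto simp: \<J>_def)
  define Q where "Q i g \<longleftrightarrow> g \<in> poly_funs I \<and> (\<exists>x. g x \<noteq> 0) \<and>
      (\<forall>x v. (\<forall>c\<in>C. ((\<lambda>t. F c (\<lambda>i. x i + t * v i)) has_real_derivative 0) (at 0)) \<and>
       (\<forall>j\<in>J. v j = 0) \<longrightarrow> g x * v i = 0)" for i g
  have "\<exists>g. Q i g" if i: "i \<in> I" for i
  proof (cases "i \<in> J")
    case True
    then have "Q i (\<lambda>_. 1)" unfolding Q_def by (auto intro: poly_funs.const)
    then show ?thesis by blast
  next
    case False
    then have dep: "\<not> alg_indep (C <+> insert i J) (adjoin_coords F)"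
      using Jmax[of "insert i J"] J(1) i by (auto simp: \<J>_def)
    show ?thesis unfolding Q_def by (rule algebraic_coordinate[OF _ J(1) i J(2) dep]) (rule F(1))
  qed
  then obtain g where "\<And>i. i \<in> I \<Longrightarrow> Q i (g i)" by metis
  then have g: "\<And>i. i \<in> I \<Longrightarrow> g i \<in> poly_funs I" "\<And>i. i \<in> I \<Longrightarrow> \<exists>x. g i x \<noteq> 0"
    "\<And>i x v. i \<in> I \<Longrightarrow> \<forall>c\<in>C. ((\<lambda>t. F c (\<lambda>i. x i + t * v i)) has_real_derivative 0) (at 0) \<Longrightarrow>
       \<forall>j\<in>J. v j = 0 \<Longrightarrow> g i x * v i = 0"
    unfolding Q_def by auto
  have finJ: "finite J" using J(1) fin(1) finite_subset by blast
  have "card (C <+> J) \<le> card I"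
    by (rule alg_indep_card_le[OF fin(1) _ _ J(2)])
      (use fin finJ F(1) J(1) in \<open>auto simp: adjoin_coords_def intro!: poly_funs.coord\<close>)
  then have card: "card (C <+> J) < card (insert None (Some ` I))"
    using fin(1) by (simp add: card_image)
  show thesis
  proof (rule that)
    show "(\<lambda>x. \<Prod>i\<in>I. g i x) \<in> poly_funs I" by (rule poly_funs_prod) (rule g(1))
    show "\<exists>x. (\<Prod>i\<in>I. g i x) \<noteq> 0" by (rule poly_funs_prod_nonzero[OF fin(1) g(1,2)])
    fix x w assume px: "(\<Prod>i\<in>I. g i x) \<noteq> 0"
    \<comment> \<open>The extra unknown \<open>None\<close> is the factor in front of \<open>w\<close>.\<close>
    define A where "A = (\<lambda>b a. case b of
        Inl c \<Rightarrow> (case a of None \<Rightarrow> - w c | Some i \<Rightarrow> M c x i)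
      | Inr j \<Rightarrow> (case a of None \<Rightarrow> 0 | Some i \<Rightarrow> if i = j then 1 else 0))"
    obtain u where u: "\<exists>a\<in>insert None (Some ` I). u a \<noteq> 0"
      "\<forall>b\<in>C <+> J. (\<Sum>a\<in>insert None (Some ` I). A b a * u a) = 0"
      using homogeneous_system[OF _ _ card, of A] fin finJ by auto
    define v where "v i = u (Some i)" for i
    have sum: "(\<Sum>a\<in>insert None (Some ` I). A b a * u a) = A b None * u None + (\<Sum>i\<in>I. A b (Some i) * v i)" for b
      using fin(1) by (simp add: sum.reindex v_def)
    have eqC: "(\<Sum>i\<in>I. M c x i * v i) = w c * u None" if "c \<in> C" for c
      using u(2)[rule_format, OF InlI[OF that]] unfolding sum by (simp add: A_def)
    have eqJ: "v j = 0" if "j \<in> J" for j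
    proof -
      have "(\<Sum>i\<in>I. (if i = j then 1 else 0) * v i) = v j"
        using that J(1) fin(1) by (subst sum.remove[of _ j]) (auto intro!: sum.neutral)
      then show ?thesis using u(2)[rule_format, OF InrI[OF that]] unfolding sum by (simp add: A_def)
    qed
    \<comment> \<open>Otherwise \<open>v\<close> lies in the kernel of the differential and vanishes
      on \<open>J\<close>, hence is zero, and the solution \<open>u\<close> would be trivial.
      Dividing by \<open>u None\<close> then solves the inhomogeneous system.\<close>
    have "u None \<noteq> 0"
    proof
      assume 0: "u None = 0"
      have "v i = 0" if i: "i \<in> I" for i
      proof -
        have "g i x * v i = 0"
          using g(3)[OF i, of x v] deriv[of _ x v] eqC eqJ 0 by simp
        then show ?thesis using px fin(1) i by auto
      qed
      then show False using u(1) 0 by (auto simp: v_def)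
    qed
    then have "(\<Sum>i\<in>I. M c x i * (v i / u None)) = w c" if "c \<in> C" for c
      using eqC[OF that] by (simp add: sum_divide_distrib[symmetric])
    then show "\<exists>v. \<forall>c\<in>C. (\<Sum>i\<in>I. M c x i * v i) = w c"
      by (intro exI[of _ "\<lambda>i. v i / u None"]) blast
  qed
qed

section \<open>Matrices supported on a graph\<close>

definition outer :: "real^'v \<Rightarrow> real^'v \<Rightarrow> real^'v^'v" where
  "outer a b = (\<chi> i j. a $ i * b $ j)"

definition supp :: "'v ugraph \<Rightarrow> 'v \<Rightarrow> 'v \<Rightarrow> bool" where
  "supp H i j \<longleftrightarrow> (i = j \<and> i \<in> verts H) \<or> {i, j} \<in> edges H"

definition graph_mats :: "'v::finite ugraph \<Rightarrow> (real^'v^'v) set" where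
  "graph_mats H = {K. transpose K = K \<and> (\<forall>i j. \<not> supp H i j \<longrightarrow> K $ i $ j = 0)}"

text \<open>The orthogonal projection onto \<open>graph_mats H\<close> for the entrywise inner
  product. On symmetric matrices it carries the same information as \<open>phi H\<close>, but with
  values in an inner product space.\<close>

definition graph_proj :: "'v::finite ugraph \<Rightarrow> real^'v^'v \<Rightarrow> real^'v^'v" where
  "graph_proj H A = (\<chi> i j. if supp H i j then (A $ i $ j + A $ j $ i) / 2 else 0)"

definition stress_free :: "'v::finite ugraph \<Rightarrow> 'r set \<Rightarrow> ('r \<Rightarrow> real^'v) \<Rightarrow> bool" where
  "stress_free H R vs \<longleftrightarrow> (\<forall>K\<in>graph_mats H. (\<forall>\<rho>\<in>R. K *v vs \<rho> = 0) \<longrightarrow> K = 0)"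

lemma supp_commute: "supp H i j \<longleftrightarrow> supp H j i"
  unfolding supp_def by (auto simp: insert_commute)

lemma supp_verts: "simple_graph H \<Longrightarrow> supp H i j \<Longrightarrow> i \<in> verts H \<and> j \<in> verts H"
  unfolding supp_def simple_graph_def by auto

lemma symmetric_entry: "transpose S = S \<Longrightarrow> S $ i $ j = S $ j $ i"
  by (metis transpose_def vec_lambda_beta)

lemma symmetricI: "(\<And>i j. S $ i $ j = S $ j $ i) \<Longrightarrow> transpose S = S"
  by (simp add: transpose_def vec_eq_iff)

lemma graph_proj_mem: "graph_proj H A \<in> graph_mats H"
  unfolding graph_mats_def graph_proj_def
  by (auto intro!: symmetricI simp: supp_commute add.commute)

lemma graph_proj_id: "K \<in> graph_mats H \<Longrightarrow> graph_proj H K = K"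
  unfolding graph_mats_def graph_proj_def by (auto simp: vec_eq_iff symmetric_entry[of K])

lemma linear_graph_proj: "linear (graph_proj H)"
  by (rule linearI) (auto simp: graph_proj_def vec_eq_iff algebra_simps add_divide_distrib)

lemma subspace_graph_mats: "subspace (graph_mats H)"
proof -
  have "graph_mats H = range (graph_proj H)" using graph_proj_mem graph_proj_id by (metis equalityI image_subsetI rangeI subsetI)
  then show ?thesis using linear_subspace_image[OF linear_graph_proj subspace_UNIV] by metis
qed

lemma inner_matrix: "(A :: real^'v^'v::finite) \<bullet> B = (\<Sum>i\<in>UNIV. \<Sum>j\<in>UNIV. A $ i $ j * B $ i $ j)"
  by (simp add: inner_vec_def)

lemma inner_graph_proj:
  assumes "K \<in> graph_mats H"
  shows "K \<bullet> graph_proj H A = K \<bullet> A"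
proof -
  have K: "K $ i $ j = K $ j $ i" "\<not> supp H i j \<Longrightarrow> K $ i $ j = 0" for i j
    using assms symmetric_entry[of K] unfolding graph_mats_def by auto
  have "K \<bullet> graph_proj H A = (\<Sum>i\<in>UNIV. \<Sum>j\<in>UNIV. K $ i $ j * A $ i $ j / 2 + K $ i $ j * A $ j $ i / 2)"
    unfolding inner_matrix graph_proj_def by (intro sum.cong refl) (auto simp: K(2) algebra_simps add_divide_distrib)
  also have "\<dots> = (\<Sum>i\<in>UNIV. \<Sum>j\<in>UNIV. K $ i $ j * A $ i $ j / 2)
      + (\<Sum>i\<in>UNIV. \<Sum>j\<in>UNIV. K $ j $ i * A $ j $ i / 2)"
    by (simp add: sum.distrib K(1)[of _ _])
  also have "(\<Sum>i\<in>UNIV. \<Sum>j\<in>UNIV. K $ j $ i * A $ j $ i / 2) = (\<Sum>i\<in>UNIV. \<Sum>j\<in>UNIV. K $ i $ j * A $ i $ j / 2)"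
    by (rule sum.swap)
  finally show ?thesis unfolding inner_matrix by (simp add: sum_divide_distrib[symmetric])
qed

lemma inner_outer: "A \<bullet> outer a b = a \<bullet> (A *v b)"
  unfolding inner_matrix outer_def
  by (simp add: inner_vec_def matrix_vector_mult_def sum_distrib_left mult_ac)

lemma bounded_bilinear_outer: "bounded_bilinear (outer :: real^'v \<Rightarrow> real^'v \<Rightarrow> real^'v^'v::finite)"
  unfolding bilinear_conv_bounded_bilinear[symmetric] bilinear_def
  by (auto intro!: linearI simp: outer_def vec_eq_iff algebra_simps)

lemma inner_symmetric_mult:
  fixes K :: "real^'v^'v::finite"
  assumes "transpose K = K"
  shows "x \<bullet> (K *v y) = (K *v x) \<bullet> y"
  using dot_lmul_matrix[of x K y] assms by (metis transpose_matrix_vector)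

text \<open>The derivative of \<open>K \<mapsto> graph_proj H (\<Sum>\<rho>. outer (vs \<rho> + K *v vs \<rho>) (vs \<rho> + K *v vs \<rho>))\<close>
  at \<open>0\<close> is self-adjoint on \<open>graph_mats H\<close> with quadratic form
  \<open>K \<mapsto> 2 * (\<Sum>\<rho>. (norm (K *v vs \<rho>))\<^sup>2)\<close>, hence invertible.\<close>

lemma stress_free_perturbation:
  fixes vs :: "'r \<Rightarrow> real^'v::finite"
  assumes "finite R" "stress_free H R vs"
  obtains \<epsilon> where "\<epsilon> > 0"
    "\<forall>w\<in>graph_mats H. norm w < \<epsilon> \<longrightarrow> (\<exists>K\<in>graph_mats H.
       graph_proj H (\<Sum>\<rho>\<in>R. outer (vs \<rho> + K *v vs \<rho>) (vs \<rho> + K *v vs \<rho>))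
         = graph_proj H (\<Sum>\<rho>\<in>R. outer (vs \<rho>) (vs \<rho>)) + w)"
proof -
  let ?\<pi> = "graph_proj H"
  let ?u = "\<lambda>A \<rho>. vs \<rho> + ?\<pi> A *v vs \<rho>"
  \<comment> \<open>Adding \<open>A - ?\<pi> A\<close> extends the perturbation map from
    \<open>graph_mats H\<close> to a self-map of the space of all matrices, whose derivative can
    then be invertible.\<close>
  define h where "h A = (A - ?\<pi> A) + ?\<pi> (\<Sum>\<rho>\<in>R. outer (?u A \<rho>) (?u A \<rho>))" for A
  define h' where "h' B = (B - ?\<pi> B) +
    ?\<pi> (\<Sum>\<rho>\<in>R. outer (vs \<rho>) (?\<pi> B *v vs \<rho>) + outer (?\<pi> B *v vs \<rho>) (vs \<rho>))" for B
  have bl\<pi>: "bounded_linear ?\<pi>" using linear_graph_proj linear_conv_bounded_linear by blast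
  have blm: "bounded_linear (\<lambda>A. ?\<pi> A *v x)" for x
  proof -
    have "linear (\<lambda>A :: real^'v^'v. A *v x)"
      by (rule linearI) (auto simp: matrix_vector_mult_def vec_eq_iff sum_distrib_left algebra_simps sum.distrib)
    then have "linear ((\<lambda>A. A *v x) \<circ> ?\<pi>)" by (rule linear_compose[OF linear_graph_proj])
    then show ?thesis unfolding linear_conv_bounded_linear o_def .
  qed
  have \<pi>0: "?\<pi> 0 = 0" by (rule linear_0[OF linear_graph_proj])
  have der: "(h has_derivative h') (at 0)"
  proof -
    have "((\<lambda>A. ?u A \<rho>) has_derivative (\<lambda>B. ?\<pi> B *v vs \<rho>)) (at 0)" for \<rho>
      using has_derivative_add[OF has_derivative_const bounded_linear_imp_has_derivative[OF blm]] by simp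
    then have "((\<lambda>A. outer (?u A \<rho>) (?u A \<rho>)) has_derivative
       (\<lambda>B. outer (?u 0 \<rho>) (?\<pi> B *v vs \<rho>) + outer (?\<pi> B *v vs \<rho>) (?u 0 \<rho>))) (at 0)" for \<rho>
      by (intro bounded_bilinear.FDERIV[OF bounded_bilinear_outer])
    then have "((\<lambda>A. outer (?u A \<rho>) (?u A \<rho>)) has_derivative
       (\<lambda>B. outer (vs \<rho>) (?\<pi> B *v vs \<rho>) + outer (?\<pi> B *v vs \<rho>) (vs \<rho>))) (at 0)" for \<rho>
      by (simp add: \<pi>0)
    then show ?thesis
      unfolding h_def h'_def
      by (intro has_derivative_add has_derivative_diff has_derivative_ident
          bounded_linear.has_derivative[OF bl\<pi>] has_derivative_sum)
  qed
  have cont: "continuous_on UNIV h"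
    unfolding h_def
    by (intro continuous_intros bounded_linear.continuous_on[OF bl\<pi>]
        bounded_linear.continuous_on[OF blm] bounded_bilinear.continuous_on[OF bounded_bilinear_outer])
  have lin: "linear h'" using der has_derivative_linear by blast
  have "inj h'"
    unfolding linear_inj_iff_eq_0[OF lin]
  proof (intro allI impI)
    fix B assume 0: "h' B = 0"
    define X where "X = (\<Sum>\<rho>\<in>R. outer (vs \<rho>) (?\<pi> B *v vs \<rho>) + outer (?\<pi> B *v vs \<rho>) (vs \<rho>))"
    have "?\<pi> (h' B) = ?\<pi> X"
      unfolding h'_def X_def[symmetric]
      by (simp add: linear_add[OF linear_graph_proj] linear_diff[OF linear_graph_proj] graph_proj_id graph_proj_mem)
    then have X0: "?\<pi> X = 0" using 0 \<pi>0 by simp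
    then have B: "B = ?\<pi> B" using 0 unfolding h'_def X_def[symmetric] by simp
    then have Bm: "B \<in> graph_mats H" using graph_proj_mem[of H B] by metis
    then have sym: "transpose B = B" by (simp add: graph_mats_def)
    have "0 = B \<bullet> X" using X0 inner_graph_proj[OF Bm, of X] by simp
    also have "X = (\<Sum>\<rho>\<in>R. outer (vs \<rho>) (B *v vs \<rho>) + outer (B *v vs \<rho>) (vs \<rho>))"
      unfolding X_def B[symmetric] ..
    also have "B \<bullet> \<dots> = (\<Sum>\<rho>\<in>R. 2 * ((B *v vs \<rho>) \<bullet> (B *v vs \<rho>)))"
      by (simp add: inner_sum_right inner_add_right inner_outer inner_symmetric_mult[OF sym])
    finally have "(\<Sum>\<rho>\<in>R. 2 * ((B *v vs \<rho>) \<bullet> (B *v vs \<rho>))) = 0" by simp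
    then have "\<forall>\<rho>\<in>R. B *v vs \<rho> = 0"
      using assms(1) by (subst (asm) sum_nonneg_eq_0_iff) auto
    then show "B = 0" using assms(2) Bm unfolding stress_free_def by blast
  qed
  obtain g where g: "linear g" "\<forall>x. h' (g x) = x"
    using linear_injective_isomorphism[OF lin \<open>inj h'\<close>] by blast
  \<comment> \<open>The open mapping theorem uses the derivative at the single point 0 and its right
    inverse \<open>g\<close>.\<close>
  have "h 0 \<in> interior (h ` UNIV)"
    by (rule sussmann_open_mapping[OF open_UNIV cont _ der, of g])
      (use g linear_conv_bounded_linear in auto)
  then obtain \<epsilon> where \<epsilon>: "\<epsilon> > 0" "ball (h 0) \<epsilon> \<subseteq> range h" unfolding mem_interior by blast
  have h0: "h 0 = ?\<pi> (\<Sum>\<rho>\<in>R. outer (vs \<rho>) (vs \<rho>))" by (simp add: h_def \<pi>0)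
  show thesis
  proof (rule that[OF \<epsilon>(1)], intro ballI impI)
    fix w assume w: "w \<in> graph_mats H" "norm w < \<epsilon>"
    have "h 0 + w \<in> ball (h 0) \<epsilon>" using w(2) by (simp add: dist_norm)
    then have "h 0 + w \<in> range h" using \<epsilon>(2) by blast
    then obtain A where A: "h A = h 0 + w" by force
    define Y where "Y = ?\<pi> (\<Sum>\<rho>\<in>R. outer (?u A \<rho>) (?u A \<rho>))"
    have "A - ?\<pi> A = h 0 + w - Y" using A unfolding h_def[of A] Y_def by (simp add: algebra_simps)
    moreover have "h 0 + w - Y \<in> graph_mats H"
      unfolding h0 Y_def by (intro subspace_add subspace_diff subspace_graph_mats graph_proj_mem w(1))
    \<comment> \<open>The difference lies in \<open>graph_mats H\<close> and is also killed by the
      projection, so it is zero and the auxiliary summand of \<open>h\<close> disappears.\<close>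
    ultimately have "A - ?\<pi> A = ?\<pi> (A - ?\<pi> A)" by (simp add: graph_proj_id)
    also have "\<dots> = 0" by (simp add: linear_diff[OF linear_graph_proj] graph_proj_id graph_proj_mem)
    finally have "Y = h 0 + w" using A unfolding h_def[of A] Y_def by simp
    then show "\<exists>K\<in>graph_mats H. ?\<pi> (\<Sum>\<rho>\<in>R. outer (vs \<rho> + K *v vs \<rho>) (vs \<rho> + K *v vs \<rho>))
         = ?\<pi> (\<Sum>\<rho>\<in>R. outer (vs \<rho>) (vs \<rho>)) + w"
      unfolding Y_def h0 using graph_proj_mem[of H A] by blast
  qed
qed

section \<open>Sums of outer products and low rank\<close>

lemma outer_sum_entry: "(\<Sum>\<rho>\<in>R. outer (u \<rho>) (u \<rho>)) $ i $ j = (\<Sum>\<rho>\<in>R. u \<rho> $ i * u \<rho> $ j)"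
  by (simp add: outer_def)

lemma transpose_outer_sum: "transpose (\<Sum>\<rho>\<in>R. outer (u \<rho>) (u \<rho>)) = (\<Sum>\<rho>\<in>R. outer (u \<rho>) (u \<rho>))"
  by (rule symmetricI) (simp add: outer_def mult.commute)

lemma rank_outer_sum_le:
  fixes u :: "'r \<Rightarrow> real^'v::finite"
  assumes "finite R"
  shows "rank (\<Sum>\<rho>\<in>R. outer (u \<rho>) (u \<rho>)) \<le> card R"
proof -
  let ?S = "\<Sum>\<rho>\<in>R. outer (u \<rho>) (u \<rho>)"
  have "column j ?S \<in> span (u ` R)" for j
  proof -
    have "column j ?S = (\<Sum>\<rho>\<in>R. u \<rho> $ j *\<^sub>R u \<rho>)"
      by (simp add: column_def vec_eq_iff outer_def mult.commute)
    also have "\<dots> \<in> span (u ` R)" by (intro span_sum span_scale span_base) auto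
    finally show ?thesis .
  qed
  then have "columns ?S \<subseteq> span (u ` R)" by (auto simp: columns_def)
  then have "dim (columns ?S) \<le> card (u ` R)" using assms by (intro dim_le_card) auto
  also have "\<dots> \<le> card R" using assms by (rule card_image_le)
  finally show ?thesis by (simp add: column_rank_def)
qed

text \<open>Lagrange reduction: subtracting a multiple of \<open>outer (S *v x) (S *v x)\<close> for
  a vector \<open>x\<close> with \<open>x \<bullet> (S *v x) \<noteq> 0\<close> lowers the rank. If
  there is no such \<open>x\<close>, polarisation gives \<open>S = 0\<close>.\<close>

lemma symmetric_rank_decomposition:
  fixes S :: "real^'v^'v::finite"
  assumes "transpose S = S" "rank S \<le> n"
  shows "\<exists>d p. S = (\<Sum>s<n. d s *\<^sub>R outer (p s) (p s))"
  using assms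
proof (induction n arbitrary: S)
  case 0
  then have "range (\<lambda>x. S *v x) \<subseteq> {0}" by (simp add: rank_dim_range)
  then have "S = 0" by (auto simp: matrix_eq)
  then show ?case by simp
next
  case (Suc n)
  show ?case
  proof (cases "\<forall>x. x \<bullet> (S *v x) = 0")
    case True
    have "x \<bullet> (S *v y) = 0" for x y
    proof -
      have "(x + y) \<bullet> (S *v (x + y)) = 2 * (x \<bullet> (S *v y))"
        using True inner_symmetric_mult[OF Suc.prems(1), of y x]
        by (simp add: matrix_vector_right_distrib inner_add_left inner_add_right inner_commute)
      then show ?thesis using True by simp
    qed
    then have "S *v y = 0" for y by (metis inner_eq_zero_iff)
    then have "S = 0" by (simp add: matrix_eq)
    then show ?thesis by (intro exI[of _ "\<lambda>_. 0"]) simp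
  next
    case False
    then obtain x where x: "x \<bullet> (S *v x) \<noteq> 0" by blast
    define q where "q = x \<bullet> (S *v x)"
    define T where "T = S - (1 / q) *\<^sub>R outer (S *v x) (S *v x)"
    have "transpose T = T"
      using symmetric_entry[OF Suc.prems(1)] by (intro symmetricI) (simp add: T_def outer_def mult.commute)
    have outer_mult: "outer a b *v y = (b \<bullet> y) *\<^sub>R a" for a b y :: "real^'v"
      by (simp add: outer_def matrix_vector_mult_def vec_eq_iff inner_vec_def sum_distrib_right sum_distrib_left mult_ac)
    have Ty: "T *v y = S *v (y - ((x \<bullet> (S *v y)) / q) *\<^sub>R x)" for y
      unfolding T_def
      by (simp add: matrix_vector_mult_diff_rdistrib scaleR_matrix_vector_assoc[symmetric] outer_mult
        matrix_vector_mult_diff_distrib matrix_vector_mult_scaleR inner_symmetric_mult[OF Suc.prems(1), of x y])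
    have orth: "x \<bullet> (T *v y) = 0" for y
      using x unfolding Ty by (simp add: matrix_vector_mult_diff_distrib matrix_vector_mult_scaleR inner_diff_right q_def)
    have sub: "subspace (range (\<lambda>y. T *v y))" "subspace (range (\<lambda>y. S *v y))"
      by (intro linear_subspace_image matrix_vector_mul_linear subspace_UNIV)+
    have "range (\<lambda>y. T *v y) \<subseteq> range (\<lambda>y. S *v y)" using Ty by auto
    \<comment> \<open>The range of \<open>T\<close> is orthogonal to \<open>x\<close>, whereas
      \<open>x \<bullet> (S *v x)\<close> is nonzero; hence the range shrinks strictly.\<close>
    moreover have "S *v x \<notin> range (\<lambda>y. T *v y)" using orth x by auto
    ultimately have "range (\<lambda>y. T *v y) \<subset> range (\<lambda>y. S *v y)" by blast
    then have "rank T < rank S"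
      unfolding rank_dim_range using dim_psubset sub by (metis span_eq_iff)
    then obtain d p where dp: "T = (\<Sum>s<n. d s *\<^sub>R outer (p s) (p s))"
      using Suc.IH[OF \<open>transpose T = T\<close>] Suc.prems(2) by fastforce
    have "S = T + (1 / q) *\<^sub>R outer (S *v x) (S *v x)" by (simp add: T_def)
    then have "S = (\<Sum>s<Suc n. (d(n := 1 / q)) s *\<^sub>R outer ((p(n := S *v x)) s) ((p(n := S *v x)) s))"
      by (simp add: dp)
    then show ?thesis by blast
  qed
qed

section \<open>Stress-free configurations\<close>

text \<open>Chooses one of the two orderings of the endpoints of an edge; on symmetric matrices the
  choice is immaterial.\<close>

definition ends :: "'v + 'v set \<Rightarrow> 'v \<times> 'v" where
  "ends c = (case c of Inl i \<Rightarrow> (i, i) | Inr e \<Rightarrow> (SOME ij. e = {fst ij, snd ij}))"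

lemma ends_Inr:
  assumes "simple_graph H" "e \<in> edges H"
  shows "{fst (ends (Inr e)), snd (ends (Inr e))} = e"
proof -
  have "card e = 2" using assms by (simp add: simple_graph_def)
  then obtain i j where "e = {fst (i, j), snd (i, j)}" by (auto simp: card_2_iff)
  then show ?thesis
    unfolding ends_def sum.case by (metis (mono_tags, lifting) someI)
qed

lemma ends_supp:
  assumes "simple_graph H" "c \<in> coords H"
  shows "supp H (fst (ends c)) (snd (ends c))"
  using assms(2)
proof
  fix e assume "c = Inr e" "e \<in> edges H"
  then show ?thesis using ends_Inr[OF assms(1), of e] by (simp add: supp_def)
qed (simp add: ends_def supp_def)

lemma phi_ends:
  assumes "simple_graph H" "transpose S = S" "c \<in> coords H"
  shows "phi H S c = S $ fst (ends c) $ snd (ends c)"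
  using assms(3)
proof
  fix e assume e: "c = Inr e" "e \<in> edges H"
  define a b where "a = fst (ends (Inr e))" and "b = snd (ends (Inr e))"
  have ab: "e = {a, b}" using ends_Inr[OF assms(1) e(2)] by (simp add: a_def b_def)
  have "(THE s. \<exists>i j. e = {i, j} \<and> s = S $ i $ j) = S $ a $ b"
  proof (rule the_equality)
    show "\<exists>i j. e = {i, j} \<and> S $ a $ b = S $ i $ j" using ab by blast
    fix s assume "\<exists>i j. e = {i, j} \<and> s = S $ i $ j"
    then show "s = S $ a $ b" using ab symmetric_entry[OF assms(2), of a b] by (auto simp: doubleton_eq_iff)
  qed
  then show ?thesis using e assms(3) by (simp add: phi_def a_def b_def)
qed (use assms(3) in \<open>simp add: phi_def ends_def\<close>)

lemma supp_ends:
  assumes "simple_graph H" "supp H i j"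
  obtains c where "c \<in> coords H" "(i, j) = ends c \<or> (j, i) = ends c"
proof (cases "i = j \<and> i \<in> verts H")
  case True
  then show thesis by (intro that[of "Inl i"]) (auto simp: ends_def)
next
  case False
  then have e: "{i, j} \<in> edges H" using assms(2) by (auto simp: supp_def)
  have "(i, j) = ends (Inr {i, j}) \<or> (j, i) = ends (Inr {i, j})"
    using ends_Inr[OF assms(1) e] by (auto simp: doubleton_eq_iff prod_eq_iff)
  then show thesis using e by (intro that[of "Inr {i, j}"]) auto
qed

lemma phi_extensional: "phi H S \<in> coords H \<rightarrow>\<^sub>E UNIV"
  unfolding phi_def by auto

lemma phi_eq_of_graph_proj:
  assumes "simple_graph H" "transpose S = S" "transpose T = T" "graph_proj H S = graph_proj H T"
  shows "phi H S = phi H T"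
proof (rule ext)
  fix c
  show "phi H S c = phi H T c"
  proof (cases "c \<in> coords H")
    case True
    have "graph_proj H S $ fst (ends c) $ snd (ends c) = graph_proj H T $ fst (ends c) $ snd (ends c)"
      using assms(4) by simp
    then show ?thesis
      using True ends_supp[OF assms(1) True] phi_ends[OF assms(1)] assms(2,3)
        symmetric_entry[OF assms(2)] symmetric_entry[OF assms(3)]
      by (simp add: graph_proj_def)
  qed (simp add: phi_def)
qed

lemma norm_matrix_le:
  fixes A :: "real^'v^'v::finite"
  assumes "\<And>i j. \<bar>A $ i $ j\<bar> \<le> \<delta>"
  shows "norm A \<le> real (CARD('v)) * (real (CARD('v)) * \<delta>)"
proof -
  have "norm (A $ i) \<le> real (CARD('v)) * \<delta>" for i
    using norm_le_l1_cart[of "A $ i"] sum_bounded_above[of UNIV "\<lambda>j. \<bar>A $ i $ j\<bar>" \<delta>] assms by simp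
  then show ?thesis
    using L2_set_le_sum[of UNIV "\<lambda>i. norm (A $ i)"]
      sum_bounded_above[of UNIV "\<lambda>i. norm (A $ i)" "real (CARD('v)) * \<delta>"]
    by (simp add: norm_vec_def)
qed

lemma stress_perturbed_supported:
  assumes "simple_graph H" "K \<in> graph_mats H" "\<And>i. i \<notin> verts H \<Longrightarrow> v $ i = 0" "i \<notin> verts H"
  shows "(v + K *v v) $ i = 0"
proof -
  have "K $ i $ j = 0" for j
    using supp_verts[OF assms(1), of i j] assms(2,4) by (auto simp: graph_mats_def)
  then show ?thesis using assms(3,4) by (simp add: matrix_vector_mult_def)
qed

section \<open>From stress-free configurations to density and completions\<close>

definition phi_dense :: "'v::finite ugraph \<Rightarrow> nat \<Rightarrow> bool" where
  "phi_dense H n \<longleftrightarrow> (\<forall>q\<in>poly_funs (coords H).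
     (\<forall>S\<in>sym_rank_le (verts H) n. q (phi H S) = 0) \<longrightarrow> (\<forall>z. q z = 0))"

lemma phi_denseD:
  assumes "phi_dense H n" "q \<in> poly_funs (coords H)"
    "\<And>S. S \<in> sym_rank_le (verts H) n \<Longrightarrow> q (phi H S) = 0"
  shows "q z = 0"
  using assms unfolding phi_dense_def by auto

text \<open>Perturbing \<open>vs\<close> realises every assignment of the coordinates near
  \<open>phi H\<close> of its Gram matrix by a matrix of rank at most \<open>n\<close>, and a
  polynomial vanishing near a point is zero.\<close>

lemma stress_free_dense:
  fixes vs :: "'r \<Rightarrow> real^'v::finite"
  assumes H: "simple_graph H" and R: "finite R" "card R \<le> n" and free: "stress_free H R vs"
    and vs: "\<And>\<rho> i. \<rho> \<in> R \<Longrightarrow> i \<notin> verts H \<Longrightarrow> vs \<rho> $ i = 0"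
  shows "phi_dense H n"
  unfolding phi_dense_def
proof (intro ballI impI allI)
  fix q z
  assume q: "q \<in> poly_funs (coords H)" "\<forall>S\<in>sym_rank_le (verts H) n. q (phi H S) = 0"
  obtain \<epsilon> where \<epsilon>: "\<epsilon> > 0" "\<forall>w\<in>graph_mats H. norm w < \<epsilon> \<longrightarrow> (\<exists>K\<in>graph_mats H.
       graph_proj H (\<Sum>\<rho>\<in>R. outer (vs \<rho> + K *v vs \<rho>) (vs \<rho> + K *v vs \<rho>))
         = graph_proj H (\<Sum>\<rho>\<in>R. outer (vs \<rho>) (vs \<rho>)) + w)"
    by (rule stress_free_perturbation[OF R(1) free])
  let ?S0 = "\<Sum>\<rho>\<in>R. outer (vs \<rho>) (vs \<rho>)"
  define N where "N = real (CARD('v)) * real (CARD('v))"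
  have N: "N > 0" by (simp add: N_def)
  \<comment> \<open>An entrywise bound \<open>\<delta>\<close> gives norm at most
    \<open>N * \<delta> = \<epsilon> / 2\<close>, within the radius of the perturbation
    lemma.\<close>
  define \<delta> where "\<delta> = \<epsilon> / (2 * N)"
  have \<delta>: "\<delta> > 0" using \<epsilon>(1) N by (simp add: \<delta>_def)
  show "q z = 0"
  proof (rule poly_funs_eq_0_near[OF _ q(1) \<delta>])
    show "finite (coords H)" by simp
    fix y assume y: "\<And>c. c \<in> coords H \<Longrightarrow> \<bar>y c - phi H ?S0 c\<bar> < \<delta>"
    \<comment> \<open>\<open>coord\<close> undoes \<open>ends\<close>, so \<open>w\<close> is the
      symmetric matrix carrying the prescribed change of coordinates.\<close>
    define coord where "coord i j = (if i = j then Inl i else Inr {i, j} :: 'v + 'v set)" for i j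
    define w :: "real^'v^'v" where
      "w = (\<chi> i j. if supp H i j then y (coord i j) - phi H ?S0 (coord i j) else 0)"
    have coord_mem: "coord i j \<in> coords H" if "supp H i j" for i j
      using that H by (auto simp: coord_def supp_def simple_graph_def)
    have "w \<in> graph_mats H"
      unfolding graph_mats_def
      by (auto intro!: symmetricI simp: w_def supp_commute coord_def insert_commute)
    moreover have "norm w < \<epsilon>"
    proof -
      have "\<bar>w $ i $ j\<bar> \<le> \<delta>" for i j
        using y[OF coord_mem, of i j] \<delta> by (cases "supp H i j") (simp_all add: w_def)
      then have "norm w \<le> N * \<delta>" using norm_matrix_le[of w \<delta>] by (simp add: N_def)
      also have "\<dots> < \<epsilon>" using N \<epsilon>(1) by (simp add: \<delta>_def)
      finally show ?thesis .
    qed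
    ultimately obtain K where K: "K \<in> graph_mats H"
      "graph_proj H (\<Sum>\<rho>\<in>R. outer (vs \<rho> + K *v vs \<rho>) (vs \<rho> + K *v vs \<rho>)) = graph_proj H ?S0 + w"
      using \<epsilon>(2) by blast
    define S where "S = (\<Sum>\<rho>\<in>R. outer (vs \<rho> + K *v vs \<rho>) (vs \<rho> + K *v vs \<rho>))"
    have symS: "transpose S = S" unfolding S_def by (rule transpose_outer_sum)
    have "S $ i $ j = 0" if "i \<notin> verts H \<or> j \<notin> verts H" for i j
      unfolding S_def outer_sum_entry
      using that stress_perturbed_supported[OF H K(1) vs] by (intro sum.neutral) auto
    then have "S \<in> sym_on (verts H)" using symS by (auto simp: sym_on_def)
    moreover have "rank S \<le> n" unfolding S_def by (rule order_trans[OF rank_outer_sum_le[OF R(1)] R(2)])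
    ultimately have "q (phi H S) = 0" using q(2) by (simp add: sym_rank_le_def)
    moreover have "phi H S c = y c" if c: "c \<in> coords H" for c
    proof -
      let ?a = "fst (ends c)" and ?b = "snd (ends c)"
      have sup: "supp H ?a ?b" by (rule ends_supp[OF H c])
      have "coord ?a ?b = c"
        using c
      proof
        fix e assume e: "c = Inr e" "e \<in> edges H"
        have "card {?a, ?b} = 2" using H e ends_Inr[OF H e(2)] by (simp add: simple_graph_def)
        then have "?a \<noteq> ?b" by auto
        then show ?thesis using ends_Inr[OF H e(2)] e(1) by (simp add: coord_def)
      qed (simp add: coord_def ends_def)
      then have "w $ ?a $ ?b = y c - phi H ?S0 c" using sup by (simp add: w_def)
      moreover have "graph_proj H S $ ?a $ ?b = S $ ?a $ ?b"
        using sup symmetric_entry[OF symS, of ?a ?b] by (simp add: graph_proj_def)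
      moreover have "graph_proj H ?S0 $ ?a $ ?b = phi H ?S0 c"
        using sup symmetric_entry[OF transpose_outer_sum, of vs R ?a ?b]
          phi_ends[OF H transpose_outer_sum c, of vs R] by (simp add: graph_proj_def)
      moreover have "phi H S c = S $ ?a $ ?b" by (rule phi_ends[OF H symS c])
      ultimately show ?thesis using K(2) unfolding S_def[symmetric] by simp
    qed
    then have "q (phi H S) = q y" by (rule poly_funs_cong[OF q(1)])
    ultimately show "q y = 0" by simp
  qed
qed

text \<open>Perturb \<open>vs\<close> so that the constrained entries become those of \<open>\<Sum>\<rho>. outer (vs \<rho>) (vs \<rho>)\<close>
  minus a small multiple of the identity, and add that multiple back.\<close>

lemma stress_free_pos_def:
  fixes vs :: "'r \<Rightarrow> real^'v::finite"
  assumes H: "simple_graph H" and R: "finite R" and free: "stress_free H R vs"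
    and vs: "\<And>\<rho> i. \<rho> \<in> R \<Longrightarrow> i \<notin> verts H \<Longrightarrow> vs \<rho> $ i = 0"
  shows "\<exists>S. pos_def_on (verts H) S \<and> phi H (\<Sum>\<rho>\<in>R. outer (vs \<rho>) (vs \<rho>)) = phi H S"
proof -
  obtain \<epsilon> where \<epsilon>: "\<epsilon> > 0" "\<forall>w\<in>graph_mats H. norm w < \<epsilon> \<longrightarrow> (\<exists>K\<in>graph_mats H.
       graph_proj H (\<Sum>\<rho>\<in>R. outer (vs \<rho> + K *v vs \<rho>) (vs \<rho> + K *v vs \<rho>))
         = graph_proj H (\<Sum>\<rho>\<in>R. outer (vs \<rho>) (vs \<rho>)) + w)"
    by (rule stress_free_perturbation[OF R free])
  define D :: "real^'v^'v" where "D = (\<chi> i j. if i = j \<and> i \<in> verts H then 1 else 0)"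
  have D: "D \<in> graph_mats H"
    unfolding graph_mats_def by (auto intro!: symmetricI simp: D_def supp_def)
  define \<delta> where "\<delta> = \<epsilon> / (norm D + 1)"
  have \<delta>: "\<delta> > 0" using \<epsilon>(1) by (simp add: \<delta>_def add_nonneg_pos)
  have "- \<delta> *\<^sub>R D \<in> graph_mats H" by (rule subspace_scale[OF subspace_graph_mats D])
  moreover have "norm (- \<delta> *\<^sub>R D) < \<epsilon>"
  proof -
    have "norm (- \<delta> *\<^sub>R D) = \<delta> * norm D" using \<delta> by simp
    also have "\<dots> < \<delta> * (norm D + 1)" using \<delta> by simp
    also have "\<dots> = \<epsilon>"
      using norm_ge_zero[of D] by (simp add: \<delta>_def add_nonneg_eq_0_iff)
    finally show ?thesis .
  qed
  ultimately obtain K where K: "K \<in> graph_mats H"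
    "graph_proj H (\<Sum>\<rho>\<in>R. outer (vs \<rho> + K *v vs \<rho>) (vs \<rho> + K *v vs \<rho>))
      = graph_proj H (\<Sum>\<rho>\<in>R. outer (vs \<rho>) (vs \<rho>)) + - \<delta> *\<^sub>R D"
    using \<epsilon>(2) by blast
  define u where "u = (\<lambda>\<rho>. vs \<rho> + K *v vs \<rho>)"
  define T where "T = (\<Sum>\<rho>\<in>R. outer (u \<rho>) (u \<rho>))"
  have symT: "transpose T = T" unfolding T_def by (rule transpose_outer_sum)
  have u0: "u \<rho> $ i = 0" if "\<rho> \<in> R" "i \<notin> verts H" for \<rho> i
    unfolding u_def using stress_perturbed_supported[OF H K(1) vs] that by blast
  define S where "S = T + \<delta> *\<^sub>R D"
  have symS: "transpose S = S"
    using symmetric_entry[OF symT] by (intro symmetricI) (auto simp: S_def D_def)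
  have "S $ i $ j = 0" if "i \<notin> verts H \<or> j \<notin> verts H" for i j
  proof -
    have "T $ i $ j = 0" unfolding T_def outer_sum_entry using u0 that by (intro sum.neutral) auto
    then show ?thesis using that by (auto simp: S_def D_def)
  qed
  then have "S \<in> sym_on (verts H)" using symS by (auto simp: sym_on_def)
  moreover have "x \<bullet> (S *v x) > 0" if x: "x \<noteq> 0" "\<forall>i. i \<notin> verts H \<longrightarrow> x $ i = 0" for x
  proof -
    have "x \<bullet> (T *v x) = T \<bullet> outer x x" by (rule inner_outer[symmetric])
    also have "\<dots> = (\<Sum>\<rho>\<in>R. (u \<rho> \<bullet> x)\<^sup>2)"
    proof -
      have "outer (u \<rho>) (u \<rho>) \<bullet> outer x x = (u \<rho> \<bullet> x)\<^sup>2" for \<rho>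
        by (simp add: inner_matrix outer_def inner_vec_def power2_eq_square sum_product mult_ac)
      then show ?thesis unfolding T_def by (simp add: inner_sum_left)
    qed
    also have "\<dots> \<ge> 0" by (simp add: sum_nonneg)
    finally have "x \<bullet> (T *v x) \<ge> 0" .
    moreover have "D *v x = x"
    proof -
      have "(D *v x) $ i = x $ i" for i
      proof -
        have "(D *v x) $ i = (\<Sum>j\<in>UNIV. if j = i then (if i \<in> verts H then x $ i else 0) else 0)"
          unfolding matrix_vector_mult_def D_def vec_lambda_beta by (intro sum.cong) auto
        then show ?thesis using x(2) by simp
      qed
      then show ?thesis by (simp add: vec_eq_iff)
    qed
    moreover have "S *v x = T *v x + \<delta> *\<^sub>R (D *v x)"
      by (simp add: S_def matrix_vector_mult_add_rdistrib scaleR_matrix_vector_assoc)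
    moreover have "\<delta> * (x \<bullet> x) > 0" using x(1) \<delta> by simp
    ultimately show ?thesis by (simp add: inner_add_right)
  qed
  ultimately have "pos_def_on (verts H) S" by (simp add: pos_def_on_def)
  moreover have "phi H (\<Sum>\<rho>\<in>R. outer (vs \<rho>) (vs \<rho>)) = phi H S"
  proof (rule phi_eq_of_graph_proj[OF H transpose_outer_sum symS])
    have "graph_proj H S = graph_proj H T + \<delta> *\<^sub>R D"
      by (simp add: S_def linear_add[OF linear_graph_proj] linear_scale[OF linear_graph_proj] graph_proj_id[OF D])
    then show "graph_proj H (\<Sum>\<rho>\<in>R. outer (vs \<rho>) (vs \<rho>)) = graph_proj H S"
      using K(2) by (simp add: T_def u_def)
  qed
  ultimately show ?thesis by blast
qed

section \<open>From density to generic stress-freeness\<close>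

definition gram_row :: "'v set \<Rightarrow> (nat \<times> 'v \<Rightarrow> real) \<Rightarrow> nat \<Rightarrow> real^'v::finite" where
  "gram_row U P s = (\<chi> v. if v \<in> U then P (s, v) else 0)"

lemma gram_eq_outer_sum: "gram U n P = (\<Sum>s<n. outer (gram_row U P s) (gram_row U P s))"
  by (auto simp: gram_def gram_row_def outer_def vec_eq_iff)

text \<open>Density concerns all symmetric matrices of bounded rank, Gram matrices only the positive
  semidefinite ones. In \<open>S = (\<Sum>s<n. d s *\<^sub>R outer (p s) (p s))\<close> the weights
  are varied: a relation holding for positive weights holds for all weights, including
  \<open>d\<close>.\<close>

lemma gram_entries_alg_indep:
  fixes H :: "'v::finite ugraph"
  assumes H: "simple_graph H"
    and dense: "phi_dense H n"
  shows "alg_indep (coords H) (\<lambda>c P. \<Sum>s<n. P (s, fst (ends c)) * P (s, snd (ends c)) :: real)"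
  unfolding alg_indep_def
proof (intro ballI impI allI)
  fix q :: "('v + 'v set \<Rightarrow> real) \<Rightarrow> real" and z :: "'v + 'v set \<Rightarrow> real"
  assume q: "q \<in> poly_funs (coords H)"
    "\<forall>P. q (\<lambda>c. \<Sum>s<n. P (s, fst (ends c)) * P (s, snd (ends c))) = 0"
  show "q z = 0"
  proof (rule phi_denseD[OF dense q(1)])
    fix S assume "S \<in> sym_rank_le (verts H) n"
    then have S: "transpose S = S" "rank S \<le> n" by (auto simp: sym_rank_le_def sym_on_def)
    obtain d p where dp: "S = (\<Sum>s<n. d s *\<^sub>R outer (p s) (p s))"
      using symmetric_rank_decomposition[OF S] by blast
    define f where "f c t = (\<Sum>s<n. t s * (p s $ fst (ends c) * p s $ snd (ends c)))"
      for c and t :: "nat \<Rightarrow> real"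
    have f: "f c \<in> poly_funs {..<n}" for c
      unfolding f_def[abs_def] by (intro poly_funs_sum poly_funs.mult poly_funs.const poly_funs.coord)
    have "(\<lambda>t. q (\<lambda>c. f c t)) \<in> poly_funs {..<n}"
      by (rule poly_funs_compose[OF q(1)]) (rule f)
    then have "q (\<lambda>c. f c d) = 0"
    proof (rule poly_funs_eq_0_near[OF finite_lessThan _ zero_less_one])
      \<comment> \<open>The unit box around the weights 1 contains only positive weights, whose
        square roots can be absorbed into the vectors.\<close>
      fix t :: "nat \<Rightarrow> real" assume t: "\<And>s. s \<in> {..<n} \<Longrightarrow> \<bar>t s - 1\<bar> < 1"
      have "t s = sqrt (t s) * sqrt (t s)" if "s < n" for s
        using t[of s] that by simp
      then have "f c t = (\<Sum>s<n. (sqrt (t s) * p s $ fst (ends c)) * (sqrt (t s) * p s $ snd (ends c)))" for c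
        unfolding f_def by (intro sum.cong refl) (metis (no_types, lifting) lessThan_iff mult.assoc mult.left_commute)
      then show "q (\<lambda>c. f c t) = 0"
        using q(2)[rule_format, of "\<lambda>(s, v). sqrt (t s) * p s $ v"] by simp
    qed
    moreover have "S $ i $ j = (\<Sum>s<n. d s * (p s $ i * p s $ j))" for i j
      unfolding dp by (simp add: outer_def)
    then have "phi H S c = f c d" if "c \<in> coords H" for c
      using phi_ends[OF H S(1) that] by (simp add: f_def)
    ultimately show "q (phi H S) = 0"
      using poly_funs_cong[OF q(1), of "phi H S" "\<lambda>c. f c d"] by simp
  qed
qed

text \<open>Where the differential of the Gram map followed by \<open>phi\<close> is surjective, a
  stress \<open>K\<close> can be matched on its support by a derivative \<open>D\<close>; then
  \<open>K \<bullet> K = K \<bullet> D\<close>, which is 0 because \<open>K\<close> annihilates the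
  vectors.\<close>

lemma generic_stress_free:
  fixes H :: "'v::finite ugraph"
  assumes H: "simple_graph H"
    and dense: "phi_dense H n"
  obtains p :: "(nat \<times> 'v \<Rightarrow> real) \<Rightarrow> real" where "p \<in> poly_funs ({..<n} \<times> verts H)" "\<exists>x. p x \<noteq> 0"
    "\<And>P. p P \<noteq> 0 \<Longrightarrow> stress_free H {..<n} (gram_row (verts H) P)"
proof -
  define a b where "a c = fst (ends c)" and "b c = snd (ends c)" for c :: "'v + 'v set"
  let ?I = "{..<n} \<times> verts H" and ?C = "coords H"
  define F where "F c P = (\<Sum>s<n. P (s, a c) * P (s, b c) :: real)" for c and P :: "nat \<times> 'v \<Rightarrow> real"
  \<comment> \<open>\<open>M c P i\<close> is the partial derivative of \<open>F c\<close> in the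
    coordinate \<open>i\<close>; on the diagonal, where \<open>a c = b c\<close>, the two summands
    together give the factor 2.\<close>
  define M where "M c P i = (if snd i = a c then P (fst i, b c) else 0) + (if snd i = b c then P (fst i, a c) else 0)"
    for c and P :: "nat \<times> 'v \<Rightarrow> real" and i
  have ab: "a c \<in> verts H" "b c \<in> verts H" if "c \<in> ?C" for c
    using supp_verts[OF H ends_supp[OF H that]] by (auto simp: a_def b_def)
  have fV: "finite (verts H)" by simp
  have Msum: "(\<Sum>i\<in>?I. M c P i * v i) = (\<Sum>s<n. v (s, a c) * P (s, b c) + P (s, a c) * v (s, b c))"
    if c: "c \<in> ?C" for c P v
  proof -
    have "(\<Sum>i\<in>?I. M c P i * v i) = (\<Sum>s<n. \<Sum>j\<in>verts H. M c P (s, j) * v (s, j))"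
      by (simp add: sum.cartesian_product)
    also have "\<dots> = (\<Sum>s<n. v (s, a c) * P (s, b c) + P (s, a c) * v (s, b c))"
    proof (rule sum.cong)
      fix s
      have "(\<Sum>j\<in>verts H. M c P (s, j) * v (s, j))
        = (\<Sum>j\<in>verts H. if j = a c then v (s, a c) * P (s, b c) else 0)
          + (\<Sum>j\<in>verts H. if j = b c then P (s, a c) * v (s, b c) else 0)"
        unfolding sum.distrib[symmetric] by (intro sum.cong) (auto simp: M_def algebra_simps)
      then show "(\<Sum>j\<in>verts H. M c P (s, j) * v (s, j)) = v (s, a c) * P (s, b c) + P (s, a c) * v (s, b c)"
        using ab[OF c] fV by simp
    qed simp
    finally show ?thesis .
  qed
  obtain p where p: "p \<in> poly_funs ?I" "\<exists>x. p x \<noteq> 0"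
    "\<And>P w. p P \<noteq> 0 \<Longrightarrow> \<exists>v. \<forall>c\<in>?C. (\<Sum>i\<in>?I. M c P i * v i) = w c"
  proof (rule jacobian_criterion[of ?I ?C F M])
    show "F c \<in> poly_funs ?I" if "c \<in> ?C" for c
      unfolding F_def[abs_def] using ab[OF that]
      by (intro poly_funs_sum poly_funs.mult poly_funs.coord) auto
    show "alg_indep ?C F"
      using gram_entries_alg_indep[OF H dense] unfolding F_def[abs_def] a_def b_def .
    show "((\<lambda>t. F c (\<lambda>i. x i + t * v i)) has_real_derivative (\<Sum>i\<in>?I. M c x i * v i)) (at 0)"
      if "c \<in> ?C" for c x v
      unfolding F_def Msum[OF that] by (auto intro!: derivative_eq_intros sum.cong)
  qed auto
  show thesis
  proof (rule that[OF p(1,2)])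
    fix P assume "p P \<noteq> 0"
    let ?g = "gram_row (verts H) P"
    show "stress_free H {..<n} ?g"
      unfolding stress_free_def
    proof (intro ballI impI)
      fix K assume K: "K \<in> graph_mats H" "\<forall>s\<in>{..<n}. K *v ?g s = 0"
      then have symK: "transpose K = K" by (simp add: graph_mats_def)
      \<comment> \<open>The target of the surjective differential is the list of entries of
        \<open>K\<close> itself.\<close>
      obtain v where v: "\<forall>c\<in>?C. (\<Sum>i\<in>?I. M c P i * v i) = K $ a c $ b c"
        using p(3)[OF \<open>p P \<noteq> 0\<close>, of "\<lambda>c. K $ a c $ b c"] by blast
      let ?v = "gram_row (verts H) v"
      define D where "D = (\<Sum>s<n. outer (?v s) (?g s) + outer (?g s) (?v s))"
      have symD: "D $ i $ j = D $ j $ i" for i j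
        unfolding D_def by (simp add: outer_def algebra_simps)
      have KD: "K $ i $ j * K $ i $ j = K $ i $ j * D $ i $ j" for i j
      proof (cases "supp H i j")
        case True
        obtain c where c: "c \<in> ?C" "(i, j) = ends c \<or> (j, i) = ends c"
          using supp_ends[OF H True] by blast
        have "K $ a c $ b c = D $ a c $ b c"
          using v c(1) ab[OF c(1)] Msum[OF c(1), of P v]
          by (simp add: D_def outer_def gram_row_def)
        moreover have "(i = a c \<and> j = b c) \<or> (j = a c \<and> i = b c)"
          using c(2) by (auto simp: a_def b_def prod_eq_iff)
        ultimately have "K $ i $ j = D $ i $ j"
          using symD symmetric_entry[OF symK] by auto
        then show ?thesis by simp
      next
        case False
        then show ?thesis using K(1) by (simp add: graph_mats_def)
      qed
      have "K \<bullet> K = K \<bullet> D" unfolding inner_matrix by (simp add: KD)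
      also have "\<dots> = (\<Sum>s<n. ?v s \<bullet> (K *v ?g s) + (K *v ?g s) \<bullet> ?v s)"
        unfolding D_def by (simp add: inner_sum_right inner_add_right inner_outer inner_symmetric_mult[OF symK])
      also have "\<dots> = 0" using K(2) by simp
      finally show "K = 0" by simp
    qed
  qed
qed

section \<open>Block-diagonal configurations\<close>

lemma zariski_dim_phi_iff:
  fixes H :: "'v::finite ugraph"
  assumes "simple_graph H"
  shows "zariski_dim (coords H) (phi H ` sym_rank_le (verts H) n) = enat (card (verts H) + card (edges H))
    \<longleftrightarrow> phi_dense H n"
proof -
  have "(0 :: real^'v^'v) \<in> sym_rank_le (verts H) n"
    by (auto simp: sym_rank_le_def sym_on_def transpose_def vec_eq_iff)
  then have ne: "phi H ` sym_rank_le (verts H) n \<noteq> {}" by blast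
  have sub: "phi H ` sym_rank_le (verts H) n \<subseteq> coords H \<rightarrow>\<^sub>E UNIV"
    using phi_extensional by blast
  have "card (coords H) = card (verts H) + card (edges H)" by (simp add: card_Plus)
  then show ?thesis
    using zariski_dim_eq_card_iff[OF _ sub ne] by (simp add: phi_dense_def)
qed

lemma graph_rank_le:
  assumes "simple_graph H" "phi_dense H n"
  shows "graph_rank H \<le> n"
  unfolding graph_rank_def zariski_dim_phi_iff[OF assms(1)] by (rule Least_le) fact

text \<open>The \<open>LEAST\<close> in \<open>graph_rank\<close> is attained because the standard
  basis vectors of the vertices form a stress-free configuration; density then passes to every
  larger \<open>n\<close>, as the sets of matrices are nested.\<close>

lemma graph_rank_dense:
  fixes H :: "'v::finite ugraph"
  assumes H: "simple_graph H" and "graph_rank H \<le> n"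
  shows "phi_dense H n"
proof -
  define e :: "'v \<Rightarrow> real^'v" where "e i = (if i \<in> verts H then axis i 1 else 0)" for i
  have "phi_dense H (CARD('v))"
  proof (rule stress_free_dense[OF H, of "UNIV :: 'v set" _ e])
    show "stress_free H UNIV e"
      unfolding stress_free_def
    proof (intro ballI impI)
      fix K assume K: "K \<in> graph_mats H" "\<forall>i\<in>UNIV. K *v e i = 0"
      have "K $ j $ i = 0" for i j
      proof (cases "i \<in> verts H")
        case True
        then have "K *v axis i 1 = 0" using K(2)[rule_format, of i] by (simp add: e_def)
        then show ?thesis by (simp add: matrix_vector_mult_basis column_def vec_eq_iff)
      next
        case False
        then show ?thesis using supp_verts[OF H, of j i] K(1) by (auto simp: graph_mats_def)
      qed
      then show "K = 0" by (simp add: vec_eq_iff)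
    qed
  qed (auto simp: e_def axis_def)
  then have "phi_dense H (graph_rank H)"
    unfolding graph_rank_def zariski_dim_phi_iff[OF H] by (rule LeastI)
  moreover have "sym_rank_le (verts H) (graph_rank H) \<subseteq> sym_rank_le (verts H) n"
    using assms(2) by (auto simp: sym_rank_le_def)
  ultimately show ?thesis unfolding phi_dense_def by (meson subsetD)
qed

text \<open>Almost every \<open>P\<close> avoids the zero set of the polynomial that certifies
  stress-freeness, and a stress-free configuration has a positive definite completion.\<close>

lemma mlt_le:
  fixes H :: "'v::finite ugraph"
  assumes H: "simple_graph H" and "phi_dense H n"
  shows "mlt H \<le> n"
proof -
  obtain p where p: "p \<in> poly_funs ({..<n} \<times> verts H)" "\<exists>x. p x \<noteq> 0"
    "\<And>P. p P \<noteq> 0 \<Longrightarrow> stress_free H {..<n} (gram_row (verts H) P)"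
    by (rule generic_stress_free[OF assms]) blast
  have "AE P in Pi\<^sub>M ({..<n} \<times> verts H) (\<lambda>_. lborel). p P \<noteq> 0"
    using p(2) poly_funs_AE_nonzero[OF _ p(1)] by auto
  then have "AE P in Pi\<^sub>M ({..<n} \<times> verts H) (\<lambda>_. lborel).
       \<exists>S. pos_def_on (verts H) S \<and> phi H (gram (verts H) n P) = phi H S"
  proof eventually_elim
    case (elim P)
    show ?case unfolding gram_eq_outer_sum
      by (rule stress_free_pos_def[OF H finite_lessThan p(3)[OF elim]]) (simp add: gram_row_def)
  qed
  then show ?thesis unfolding mlt_def by (rule Least_le)
qed

section \<open>Off-diagonal blocks and the bipartite rank\<close>

text \<open>By surjectivity some \<open>X A + B Y\<close> agrees with \<open>K\<close> on the edges,
  and \<open>K\<close> is zero off them, so the sum of the squares of \<open>K\<close> is its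
  pairing with \<open>X A + B Y\<close>. That pairing is zero, and \<open>K\<close> is real.\<close>

lemma bi_space_orthogonal:
  fixes K :: "'v \<Rightarrow> 'v \<Rightarrow> real"
  assumes fin: "finite U" "finite W"
    and onto: "(\<lambda>Z. restrict Z (biedges (between G U W))) ` bi_space (between G U W) r1 r2 X Y
        = (biedges (between G U W) \<rightarrow>\<^sub>E UNIV)"
    and K: "\<And>i j. i \<in> U \<Longrightarrow> j \<in> W \<Longrightarrow> {i, j} \<notin> edges G \<Longrightarrow> K i j = 0"
    and X: "\<And>s j. s < r1 \<Longrightarrow> j \<in> W \<Longrightarrow> (\<Sum>i\<in>U. of_real (K i j) * X (i, s)) = 0"
    and Y: "\<And>t i. t < r2 \<Longrightarrow> i \<in> U \<Longrightarrow> (\<Sum>j\<in>W. of_real (K i j) * Y (t, j)) = 0"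
    and ij: "i \<in> U" "j \<in> W"
  shows "K i j = 0"
proof -
  let ?E = "biedges (between G U W)"
  have E: "?E = {(i, j). i \<in> U \<and> j \<in> W \<and> {i, j} \<in> edges G}" by (simp add: between_def)
  have "(\<lambda>(i, j)\<in>?E. complex_of_real (K i j)) \<in> ?E \<rightarrow>\<^sub>E UNIV" by auto
  then obtain Z where Z: "Z \<in> bi_space (between G U W) r1 r2 X Y"
    "(\<lambda>(i, j)\<in>?E. complex_of_real (K i j)) = restrict Z ?E"
    unfolding onto[symmetric] by blast
  obtain A B where AB: "Z = (\<lambda>(i, j)\<in>U \<times> W. (\<Sum>s<r1. X (i, s) * A (s, j)) + (\<Sum>t<r2. B (i, t) * Y (t, j)))"
    using Z(1) unfolding bi_space_def between_def by auto
  let ?L = "\<lambda>i j. (\<Sum>s<r1. X (i, s) * A (s, j)) + (\<Sum>t<r2. B (i, t) * Y (t, j))"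
  have KZ: "complex_of_real (K i j) * of_real (K i j) = of_real (K i j) * ?L i j" if "i \<in> U" "j \<in> W" for i j
  proof (cases "{i, j} \<in> edges G")
    case True
    then have e: "(i, j) \<in> ?E" using that by (simp add: E)
    have "complex_of_real (K i j) = Z (i, j)" using fun_cong[OF Z(2), of "(i, j)"] e by simp
    then show ?thesis using that unfolding AB by simp
  qed (use K that in simp)
  have "(\<Sum>i\<in>U. \<Sum>j\<in>W. complex_of_real (K i j * K i j)) = (\<Sum>i\<in>U. \<Sum>j\<in>W. of_real (K i j) * ?L i j)"
    using KZ by (intro sum.cong) auto
  also have "\<dots> = (\<Sum>i\<in>U. \<Sum>j\<in>W. \<Sum>s<r1. of_real (K i j) * (X (i, s) * A (s, j)))
      + (\<Sum>i\<in>U. \<Sum>j\<in>W. \<Sum>t<r2. of_real (K i j) * (B (i, t) * Y (t, j)))"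
    by (simp add: distrib_left sum.distrib sum_distrib_left)
  also have "(\<Sum>i\<in>U. \<Sum>j\<in>W. \<Sum>s<r1. of_real (K i j) * (X (i, s) * A (s, j)))
      = (\<Sum>j\<in>W. \<Sum>s<r1. \<Sum>i\<in>U. of_real (K i j) * (X (i, s) * A (s, j)))"
    by (subst sum.swap, rule sum.cong[OF refl], rule sum.swap)
  also have "\<dots> = (\<Sum>j\<in>W. \<Sum>s<r1. (\<Sum>i\<in>U. of_real (K i j) * X (i, s)) * A (s, j))"
    by (simp add: sum_distrib_right mult.assoc)
  also have "\<dots> = 0" using X by simp
  also have "(\<Sum>i\<in>U. \<Sum>j\<in>W. \<Sum>t<r2. of_real (K i j) * (B (i, t) * Y (t, j)))
      = (\<Sum>i\<in>U. \<Sum>t<r2. \<Sum>j\<in>W. of_real (K i j) * (B (i, t) * Y (t, j)))"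
    by (rule sum.cong[OF refl], rule sum.swap)
  also have "\<dots> = (\<Sum>i\<in>U. \<Sum>t<r2. B (i, t) * (\<Sum>j\<in>W. of_real (K i j) * Y (t, j)))"
    by (simp add: sum_distrib_left mult_ac)
  also have "\<dots> = 0" using Y by simp
  finally have "complex_of_real (\<Sum>i\<in>U. \<Sum>j\<in>W. K i j * K i j) = 0" by simp
  then have "(\<Sum>i\<in>U. \<Sum>j\<in>W. K i j * K i j) = 0" unfolding of_real_eq_0_iff .
  then have "(\<Sum>j\<in>W. K i j * K i j) = 0"
    using fin ij by (subst (asm) sum_nonneg_eq_0_iff) (auto intro: sum_nonneg)
  then have "K i j * K i j = 0"
    using fin ij by (subst (asm) sum_nonneg_eq_0_iff) auto
  then show ?thesis by simp
qed

text \<open>Reads both \<open>X\<close> (transposed) and \<open>Y\<close> from one array of vectors,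
  so that the conditions for all pairs of blocks concern the same point.\<close>

definition birank_point :: "(nat \<times> 'v \<Rightarrow> complex) \<Rightarrow> ('v \<times> nat) + (nat \<times> 'v) \<Rightarrow> complex" where
  "birank_point y c = (case c of Inl (v, s) \<Rightarrow> y (s, v) | Inr p \<Rightarrow> y p)"

text \<open>Transports a nonvanishing polynomial in \<open>(X, Y)\<close> to the common array. As
  \<open>U\<close> and \<open>W\<close> are disjoint, \<open>X\<close> and \<open>Y\<close> use
  different entries of it.\<close>

lemma birank_generic:
  assumes "(r1, r2) \<in> birank (between G U W)" "U \<inter> W = {}"
  obtains f where "f \<in> poly_funs UNIV" "\<exists>y. f y \<noteq> 0"
    "\<And>y. f y \<noteq> 0 \<Longrightarrow>
      (\<lambda>Z. restrict Z (biedges (between G U W))) `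
         bi_space (between G U W) r1 r2 (\<lambda>(v, s)\<in>U \<times> {..<r1}. y (s, v)) (\<lambda>p\<in>{..<r2} \<times> W. y p)
       = (biedges (between G U W) \<rightarrow>\<^sub>E UNIV)"
proof -
  let ?B = "between G U W" and ?I = "(U \<times> {..<r1}) <+> ({..<r2} \<times> W)"
  have lr: "left ?B = U" "right ?B = W" by (simp_all add: between_def)
  obtain N where N: "openin (zariski ?I) N" "N \<noteq> {}"
    "\<forall>z\<in>N. (\<lambda>Z. restrict Z (biedges ?B)) ` bi_space ?B r1 r2 (\<lambda>p. z (Inl p)) (\<lambda>p. z (Inr p))
       = (biedges ?B \<rightarrow>\<^sub>E UNIV)"
    using assms(1) unfolding birank_def generically_def lr mem_Collect_eq prod.case by blast
  obtain z0 where z0: "z0 \<in> N" using N(2) by blast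
  obtain q where q: "q \<in> poly_funs ?I" "q z0 \<noteq> 0" "\<And>z. z \<in> ?I \<rightarrow>\<^sub>E UNIV \<Longrightarrow> q z \<noteq> 0 \<Longrightarrow> z \<in> N"
    using zariski_open_basis[OF N(1) z0] by auto
  show thesis
  proof (rule that[of "\<lambda>y. q (\<lambda>c. birank_point y c)"])
    show "(\<lambda>y. q (\<lambda>c. birank_point y c)) \<in> poly_funs UNIV"
      by (rule poly_funs_compose[OF q(1)])
        (auto simp: birank_point_def intro!: poly_funs.coord split: sum.split)
    \<comment> \<open>An array reproducing the generic pair \<open>z0\<close>: entries at vertices
      of \<open>U\<close> come from \<open>X\<close>, the remaining ones from
      \<open>Y\<close>.\<close>
    have "q (birank_point (\<lambda>(s, v). if v \<in> U then z0 (Inl (v, s)) else z0 (Inr (s, v)))) = q z0"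
      by (rule poly_funs_cong[OF q(1)]) (use assms(2) in \<open>auto simp: birank_point_def\<close>)
    then show "\<exists>y. q (\<lambda>c. birank_point y c) \<noteq> 0" using q(2) by metis
    fix y assume "q (\<lambda>c. birank_point y c) \<noteq> 0"
    then have "q (restrict (birank_point y) ?I) \<noteq> 0" by (simp add: poly_funs_restrict[OF q(1)])
    then have "restrict (birank_point y) ?I \<in> N" by (intro q(3)) auto
    note N(3)[rule_format, OF this]
    moreover have "(\<lambda>p. restrict (birank_point y) ?I (Inl p)) = (\<lambda>(v, s)\<in>U \<times> {..<r1}. y (s, v))"
      "(\<lambda>p. restrict (birank_point y) ?I (Inr p)) = (\<lambda>p\<in>{..<r2} \<times> W. y p)"
      by (auto simp: birank_point_def fun_eq_iff restrict_def)
    ultimately show "(\<lambda>Z. restrict Z (biedges ?B)) `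
         bi_space ?B r1 r2 (\<lambda>(v, s)\<in>U \<times> {..<r1}. y (s, v)) (\<lambda>p\<in>{..<r2} \<times> W. y p)
       = (biedges ?B \<rightarrow>\<^sub>E UNIV)" by simp
  qed
qed

section \<open>Assembling the blocks\<close>

lemma simple_graph_induced:
  assumes "simple_graph G" "U \<subseteq> verts G"
  shows "simple_graph (induced G U)"
  using assms by (auto simp: simple_graph_def induced_def intro: finite_subset)

lemma mult_gram_row_entry: "(K *v gram_row U P s) $ i = (\<Sum>j\<in>U. K $ i $ j * P (s, j))"
  unfolding matrix_vector_mult_def gram_row_def
  by (simp add: if_distrib[of "\<lambda>z. _ * z"] sum.If_cases cong: if_cong)

text \<open>For \<open>i \<noteq> j\<close> the columns of the \<open>(i, j)\<close> block of a
  stress are orthogonal to the vectors of block \<open>i\<close> and, by symmetry, its rows to those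
  of block \<open>j\<close>; this is orthogonality to the space in the birank condition.\<close>

lemma block_stress_free:
  fixes G :: "'v::finite ugraph" and V :: "nat \<Rightarrow> 'v set" and x :: "nat \<times> 'v \<Rightarrow> real"
  assumes G: "simple_graph G" and V: "(\<Union>i\<in>A. V i) = verts G"
    and diag: "\<And>i. i \<in> A \<Longrightarrow> stress_free (induced G (V i)) {..<r i} (gram_row (V i) x)"
    and off: "\<And>i j. i \<in> A \<Longrightarrow> j \<in> A \<Longrightarrow> i \<noteq> j \<Longrightarrow>
      (\<lambda>Z. restrict Z (biedges (between G (V i) (V j)))) `
         bi_space (between G (V i) (V j)) (r i) (r j)
           (\<lambda>(v, s)\<in>V i \<times> {..<r i}. of_real (x (s, v))) (\<lambda>p\<in>{..<r j} \<times> V j. of_real (x p))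
       = (biedges (between G (V i) (V j)) \<rightarrow>\<^sub>E UNIV)"
    and disj: "disjoint_family_on V A"
  shows "stress_free G (SIGMA i:A. {..<r i}) (\<lambda>(i, s). gram_row (V i) x s)"
  unfolding stress_free_def
proof (intro ballI impI)
  fix K assume K: "K \<in> graph_mats G"
    "\<forall>\<rho>\<in>SIGMA i:A. {..<r i}. K *v (case \<rho> of (i, s) \<Rightarrow> gram_row (V i) x s) = 0"
  then have sym: "K $ a $ b = K $ b $ a" for a b
    by (intro symmetric_entry) (simp add: graph_mats_def)
  have Ksupp: "K $ a $ b = 0" if "\<not> supp G a b" for a b using that K(1) by (simp add: graph_mats_def)
  \<comment> \<open>Holds for every row \<open>a\<close>, including rows outside \<open>V i\<close>;
    those rows constrain the off-diagonal blocks.\<close>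
  have K0: "(\<Sum>b\<in>V i. K $ a $ b * x (s, b)) = 0" if "i \<in> A" "s < r i" for i s a
    using K(2) that mult_gram_row_entry[of K "V i" x s a] by (auto simp: Ball_def)
  have "K $ a $ b = 0" for a b
  proof (cases "supp G a b")
    case True
    then have "a \<in> verts G" "b \<in> verts G" using supp_verts[OF G] by blast+
    then obtain i j where ij: "i \<in> A" "a \<in> V i" "j \<in> A" "b \<in> V j" using V by blast
    show ?thesis
    proof (cases "i = j")
      case True
      define L :: "real^'v^'v" where "L = (\<chi> a b. if a \<in> V i \<and> b \<in> V i then K $ a $ b else 0)"
      have "L \<in> graph_mats (induced G (V i))"
        unfolding graph_mats_def
        by (auto intro!: symmetricI simp: L_def sym Ksupp supp_def induced_def)
      moreover have "L *v gram_row (V i) x s = 0" if "s < r i" for s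
      proof -
        have "(L *v gram_row (V i) x s) $ a = 0" for a
          using K0[OF ij(1) that, of a] by (cases "a \<in> V i") (simp_all add: mult_gram_row_entry L_def)
        then show ?thesis by (simp add: vec_eq_iff)
      qed
      ultimately have "L = 0" using diag[OF ij(1)] unfolding stress_free_def by auto
      moreover have "L $ a $ b = K $ a $ b" using ij True by (simp add: L_def)
      ultimately show ?thesis by simp
    next
      case False
      have d: "V i \<inter> V j = {}" using disj ij False unfolding disjoint_family_on_def by blast
      show ?thesis
      proof (rule bi_space_orthogonal[OF _ _ off[OF ij(1,3) False] _ _ _ ij(2,4), of "\<lambda>a b. K $ a $ b"])
        show "K $ a $ b = 0" if "a \<in> V i" "b \<in> V j" "{a, b} \<notin> edges G" for a b
          using that d by (intro Ksupp) (auto simp: supp_def)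
        show "(\<Sum>a\<in>V i. complex_of_real (K $ a $ b) * (\<lambda>(v, s)\<in>V i \<times> {..<r i}. of_real (x (s, v))) (a, s)) = 0"
          if "s < r i" "b \<in> V j" for s b
        proof -
          have "(\<Sum>a\<in>V i. complex_of_real (K $ a $ b) * (\<lambda>(v, s)\<in>V i \<times> {..<r i}. of_real (x (s, v))) (a, s))
            = of_real (\<Sum>a\<in>V i. K $ b $ a * x (s, a))"
            unfolding of_real_sum using that by (intro sum.cong) (auto simp: sym[of b])
          then show ?thesis using K0[OF ij(1) that(1), of b] by simp
        qed
        show "(\<Sum>b\<in>V j. complex_of_real (K $ a $ b) * (\<lambda>p\<in>{..<r j} \<times> V j. of_real (x p)) (t, b)) = 0"
          if "t < r j" "a \<in> V i" for t a
        proof -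
          have "(\<Sum>b\<in>V j. complex_of_real (K $ a $ b) * (\<lambda>p\<in>{..<r j} \<times> V j. of_real (x p)) (t, b))
            = of_real (\<Sum>b\<in>V j. K $ a $ b * x (t, b))"
            unfolding of_real_sum using that by (intro sum.cong) auto
          then show ?thesis using K0[OF ij(3) that(1), of a] by simp
        qed
      qed auto
    qed
  qed (rule Ksupp)
  then show "K = 0" by (simp add: vec_eq_iff)
qed

theorem theorem4p4:
  fixes G :: "'v::finite ugraph" and k :: nat
    and V :: "nat \<Rightarrow> 'v set" and r :: "nat \<Rightarrow> nat"
  assumes "simple_graph G"
    and "disjoint_family_on V {1..k}" and "(\<Union>i\<in>{1..k}. V i) = verts G"
    and "\<And>i. i \<in> {1..k} \<Longrightarrow> graph_rank (induced G (V i)) \<le> r i"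
    and "\<And>i j. i \<in> {1..k} \<Longrightarrow> j \<in> {1..k} \<Longrightarrow> i \<noteq> j \<Longrightarrow>
           (r i, r j) \<in> birank (between G (V i) (V j))"
  shows "graph_rank G \<le> (\<Sum>i=1..k. r i) \<and> mlt G \<le> (\<Sum>i=1..k. r i)"
proof -
  let ?A = "{1..k}"
  \<comment> \<open>Diagonal pairs encode the rank condition and off-diagonal pairs the birank
    condition, so a single product over all pairs treats both.\<close>
  define good where "good ij x \<longleftrightarrow> (case ij of (i, j) \<Rightarrow>
      if i = j then stress_free (induced G (V i)) {..<r i} (gram_row (V i) x)
      else (\<lambda>Z. restrict Z (biedges (between G (V i) (V j)))) `
         bi_space (between G (V i) (V j)) (r i) (r j)
           (\<lambda>(v, s)\<in>V i \<times> {..<r i}. of_real (x (s, v))) (\<lambda>p\<in>{..<r j} \<times> V j. of_real (x p))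
       = (biedges (between G (V i) (V j)) \<rightarrow>\<^sub>E UNIV))" for ij and x :: "nat \<times> 'v \<Rightarrow> real"
  \<comment> \<open>The birank condition supplies complex polynomials, while stresses are real:
    nonvanishing may occur anywhere, but \<open>good\<close> is asserted only at real
    points.\<close>
  define generic where "generic f ij \<longleftrightarrow> f \<in> poly_funs UNIV \<and> (\<exists>y. f y \<noteq> 0) \<and>
      (\<forall>x. f (\<lambda>p. complex_of_real (x p)) \<noteq> 0 \<longrightarrow> good ij x)"
    for f :: "(nat \<times> 'v \<Rightarrow> complex) \<Rightarrow> complex" and ij
  have "\<exists>f. generic f ij" if mem: "ij \<in> ?A \<times> ?A" for ij
  proof -
    obtain i j where ij: "ij = (i, j)" "i \<in> ?A" "j \<in> ?A" using mem by blast
    show ?thesis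
    proof (cases "i = j")
      case True
      have U: "V i \<subseteq> verts G" using assms(3) ij(2) by blast
      have H: "simple_graph (induced G (V i))" by (rule simple_graph_induced[OF assms(1) U])
      have vH: "verts (induced G (V i)) = V i" by (simp add: induced_def)
      obtain p where p: "p \<in> poly_funs ({..<r i} \<times> V i)" "\<exists>x. p x \<noteq> 0"
        "\<And>P. p P \<noteq> 0 \<Longrightarrow> stress_free (induced G (V i)) {..<r i} (gram_row (V i) P)"
        using generic_stress_free[OF H graph_rank_dense[OF H assms(4)[OF ij(2)]]] unfolding vH by blast
      obtain f where f: "f \<in> poly_funs ({..<r i} \<times> V i)"
        "\<And>x. f (\<lambda>c. complex_of_real (x c)) = of_real (p x)"
        using complexify_poly[OF p(1)] by blast
      obtain x where "p x \<noteq> 0" using p(2) by blast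
      then have "f (\<lambda>c. complex_of_real (x c)) \<noteq> 0" using f(2) by simp
      then have "\<exists>y. f y \<noteq> 0" by blast
      then have "generic f ij"
        unfolding generic_def good_def ij(1) using True f(2) p(3) poly_funs_mono[OF f(1) subset_UNIV] by auto
      then show ?thesis by (rule exI[of "\<lambda>f. generic f ij" f])
    next
      case False
      have d: "V i \<inter> V j = {}" using assms(2) ij False unfolding disjoint_family_on_def by blast
      obtain f where f: "f \<in> poly_funs UNIV" "\<exists>y. f y \<noteq> 0" "\<And>y. f y \<noteq> 0 \<Longrightarrow>
        (\<lambda>Z. restrict Z (biedges (between G (V i) (V j)))) `
         bi_space (between G (V i) (V j)) (r i) (r j)
           (\<lambda>(v, s)\<in>V i \<times> {..<r i}. y (s, v)) (\<lambda>p\<in>{..<r j} \<times> V j. y p)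
         = (biedges (between G (V i) (V j)) \<rightarrow>\<^sub>E UNIV)"
        using birank_generic[OF assms(5)[OF ij(2,3) False] d] by blast
      have "generic f ij"
        unfolding generic_def good_def ij(1) using False f(1,2) f(3)[of "\<lambda>p. complex_of_real (_ p)"] by simp
      then show ?thesis by (rule exI[of "\<lambda>f. generic f ij" f])
    qed
  qed
  then obtain F where F: "\<And>ij. ij \<in> ?A \<times> ?A \<Longrightarrow> generic (F ij) ij" by metis
  have Fpoly: "F ij \<in> poly_funs UNIV" "\<exists>y. F ij y \<noteq> 0" if "ij \<in> ?A \<times> ?A" for ij
    using F[OF that] by (simp_all add: generic_def)
  have "\<exists>y. (\<Prod>ij\<in>?A \<times> ?A. F ij y) \<noteq> 0"
    by (rule poly_funs_prod_nonzero[of _ _ UNIV]) (use Fpoly in auto)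
  then obtain y where "(\<Prod>ij\<in>?A \<times> ?A. F ij y) \<noteq> 0" ..
  moreover have "(\<lambda>y. \<Prod>ij\<in>?A \<times> ?A. F ij y) \<in> poly_funs UNIV"
    by (rule poly_funs_prod) (rule Fpoly(1))
  \<comment> \<open>A nonzero complex polynomial is nonzero at some real point, and this provides
    one real configuration good for all pairs.\<close>
  ultimately obtain x where x: "(\<Prod>ij\<in>?A \<times> ?A. F ij (\<lambda>p. complex_of_real (x p))) \<noteq> 0"
    using complex_poly_nonzero_at_real[of "\<lambda>y. \<Prod>ij\<in>?A \<times> ?A. F ij y" UNIV y] by blast
  have good: "good ij x" if "ij \<in> ?A \<times> ?A" for ij
  proof -
    have "F ij (\<lambda>p. complex_of_real (x p)) \<noteq> 0" using x that by auto
    then show ?thesis using F[OF that] by (simp add: generic_def)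
  qed
  let ?R = "SIGMA i:?A. {..<r i}" and ?vs = "\<lambda>(i, s). gram_row (V i) x s"
  have "stress_free G ?R ?vs"
  proof (rule block_stress_free[OF assms(1,3) _ _ assms(2)])
    show "stress_free (induced G (V i)) {..<r i} (gram_row (V i) x)" if "i \<in> ?A" for i
      using good[of "(i, i)"] that by (simp add: good_def)
  qed (use good in \<open>auto simp: good_def\<close>)
  \<comment> \<open>The blocks together contain \<open>r i\<close> vectors for each
    \<open>i\<close>, which gives the sum in the bound.\<close>
  then have "phi_dense G (\<Sum>i=1..k. r i)"
  proof (rule stress_free_dense[OF assms(1), rotated 2])
    show "?vs \<rho> $ v = 0" if "\<rho> \<in> ?R" "v \<notin> verts G" for \<rho> v
      using that assms(3) by (auto simp: gram_row_def)
  qed simp_all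
  then show ?thesis using graph_rank_le mlt_le assms(1) by blast
qed

end
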